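(* Let $x_0\in\mathbb R^3$, $t_0\in\mathbb R$, $r>0$, $0<\rho\le\frac14$, $0<\ell\le\rho r$. Let $u\in L^\infty(I_r;L^2(\mathbb R^3;\mathbb R^3))$ satisfy $\operatorname{div}u=0$, and let $\chi\in C_c^\infty(Q_r)$ with $0\le\chi\le1$. With the quantities defined in the context, for every $\varepsilon\in(0,1)$, $$\mathcal V_{r,\ell}^{+,\mathrm{near}}[\chi]\le(1-\varepsilon)\,\mathcal P_{r,\ell}^{\rho}+C_{\varepsilon,\vartheta,\varphi}\,\rho^2M_{r,\rho}(u)\left(\frac r\ell\right)^5\mathcal O_{r,\ell}[\chi],$$ where one may take $$C_{\varepsilon,\vartheta,\varphi}=\frac{9\,C_\vartheta^2C_\varphi^2}{64\pi^2(1-\varepsilon)}.$$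
   Context: Notation: $B_s=B_s(x_0)\subset\mathbb R^3$, $I_r=(t_0-r^2,t_0)$, $Q_r=B_r\times I_r$. Filter: $\varphi\in C_c^\infty(B_1(0))$, $\varphi\ge0$, $\int\varphi=1$, $\varphi_\ell(x)=\ell^{-3}\varphi(x/\ell)$. Set $U_\ell=\varphi_\ell*u$ (convolution in space) and $\Omega_\ell=\operatorname{curl}U_\ell$. $C_\varphi>0$ is a fixed constant such that $\|\operatorname{curl}(\varphi_\ell*f)\|_{L^\infty(\mathbb R^3)}\le C_\varphi\ell^{-5/2}\|f\|_{L^2(\mathbb R^3)}$ for every $\ell>0$ and every $f\in L^2(\mathbb R^3;\mathbb R^3)$. Kernel cutoff: $\vartheta\in C_c^\infty(B_1(0))$ is radial, $0\le\vartheta\le1$, $\vartheta\equiv1$ on $B_{1/2}(0)$; $C_\vartheta=\int_{B_1(0)}\vartheta(w)|w|^{-2}\,dw$. Near-field strain (with $\widehat z=z/|z|$): $$\mathbb S_\ell^{\mathrm{near}}(x,t)=\frac{3}{8\pi}\,\mathrm{p.v.}\!\int_{\mathbb R^3}\vartheta\!\left(\frac z{\rho r}\right)\frac{(\widehat z\times\Omega_\ell(x-z,t))\otimes\widehat z+\widehat z\otimes(\widehat z\times\Omega_\ell(x-z,t))}{|z|^3}\,dz .$$ Quantities: $$\mathcal V_{r,\ell}^{+,\mathrm{near}}[\chi]=r\iint_{Q_r}\chi\,\bigl(\mathbb S_\ell^{\mathrm{near}}\Omega_\ell\cdot\Omega_\ell\bigr)_+\,dx\,dt,\qquad M_{r,\rho}(u)=\frac1r\,\mathrm{ess\,sup}_{t\in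 I_r}\int_{B_{(1+2\rho)r}}|u(x,t)|^2\,dx,$$ $$\mathcal O_{r,\ell}[\chi]=\frac1r\iint_{Q_r}\chi|\Omega_\ell|^2\,dx\,dt,\qquad \mathcal P_{r,\ell}^{\rho}=r\int_{I_r}\int_{B_{(1+\rho)r}}|\nabla\Omega_\ell|^2\,dx\,dt .$$ *)

theory Defs
  imports "HOL-Analysis.Analysis" "HOL-Probability.Essential_Supremum"
begin

unbundle no cross3_syntax
unbundle set_product_syntax

fun Ck :: "nat \<Rightarrow> ('a::euclidean_space \<Rightarrow> real) \<Rightarrow> bool" where
  "Ck 0 f \<longleftrightarrow> continuous_on UNIV f"
| "Ck (Suc k) f \<longleftrightarrow> (\<forall>x. f differentiable (at x)) \<and>
     (\<forall>v. Ck k (\<lambda>x. frechet_derivative f (at x) v))"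

text \<open>Members of \<open>C\<^sub>c\<^sup>\<infinity>(S)\<close>, \<open>S\<close> open, are represented by their extension by zero to the whole space.\<close>

definition Cc_infty :: "'a::euclidean_space set \<Rightarrow> ('a \<Rightarrow> real) set" where
  "Cc_infty S = {f. (\<forall>k. Ck k f) \<and> compact (closure {x. f x \<noteq> 0}) \<and> closure {x. f x \<noteq> 0} \<subseteq> S}"

definition radial :: "('a::real_normed_vector \<Rightarrow> 'b) \<Rightarrow> bool" where
  "radial f \<longleftrightarrow> (\<forall>x y. norm x = norm y \<longrightarrow> f x = f y)"

definition L2 :: "(real^3 \<Rightarrow> real^3) set" where
  "L2 = {f. f \<in> borel_measurable lebesgue \<and> integrable lebesgue (\<lambda>x. (norm (f x))\<^sup>2)}"

definition L2_norm :: "(real^3 \<Rightarrow> real^3) \<Rightarrow> real" where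
  "L2_norm f = sqrt (\<integral>x. (norm (f x))\<^sup>2 \<partial>lebesgue)"

definition Linf_norm :: "(real^3 \<Rightarrow> real^3) \<Rightarrow> ennreal" where
  "Linf_norm f = esssup lebesgue (\<lambda>x. ennreal (norm (f x)))"

text \<open>A Bochner class in \<open>L\<^sup>\<infinity>(I; L\<^sup>2(\<real>\<^sup>3; \<real>\<^sup>3))\<close> is represented by a jointly Lebesgue measurable
  function of \<open>(x, t)\<close>; values at times outside \<open>I\<close> are irrelevant. The essential supremum is
  that of the squared \<open>L\<^sup>2\<close> norm, which is finite iff that of the norm is.\<close>

definition Linf_L2 :: "real set \<Rightarrow> ((real^3) \<times> real \<Rightarrow> real^3) set" where
  "Linf_L2 I = {u. u \<in> borel_measurable (lebesgue_on (UNIV \<times> I)) \<and>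
     esssup (lebesgue_on I) (\<lambda>t. \<integral>\<^sup>+x. ennreal ((norm (u (x, t)))\<^sup>2) \<partial>lebesgue) < \<infinity>}"

definition partial :: "3 \<Rightarrow> (real^3 \<Rightarrow> real^3) \<Rightarrow> real^3 \<Rightarrow> real^3" where
  "partial i v x = frechet_derivative v (at x) (axis i 1)"

definition curl :: "(real^3 \<Rightarrow> real^3) \<Rightarrow> real^3 \<Rightarrow> real^3" where
  "curl v x = vector [partial 2 v x $ 3 - partial 3 v x $ 2,
                      partial 3 v x $ 1 - partial 1 v x $ 3,
                      partial 1 v x $ 2 - partial 2 v x $ 1]"

text \<open>The norm of the type \<open>real^3^3\<close> is the Frobenius norm.\<close>

definition grad :: "(real^3 \<Rightarrow> real^3) \<Rightarrow> real^3 \<Rightarrow> real^3^3" where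
  "grad v x = matrix (frechet_derivative v (at x))"

text \<open>\<open>div u = 0\<close> in the sense of distributions on \<open>\<real>\<^sup>3 \<times> I\<close>; the integrand is
  \<open>u \<bullet> \<nabla>\<^sub>x \<psi>\<close>, as the derivative of \<open>\<psi>\<close> is taken in the direction \<open>(u, 0)\<close>.\<close>

definition div_free :: "real set \<Rightarrow> ((real^3) \<times> real \<Rightarrow> real^3) \<Rightarrow> bool" where
  "div_free I u \<longleftrightarrow> (\<forall>\<psi> \<in> Cc_infty (UNIV \<times> I).
     (\<integral>p\<in>UNIV \<times> I. frechet_derivative \<psi> (at p) (u p, 0) \<partial>lebesgue) = 0)"

definition rescale :: "real \<Rightarrow> (real^3 \<Rightarrow> real) \<Rightarrow> real^3 \<Rightarrow> real" where
  "rescale l \<phi> x = \<phi> (x /\<^sub>R l) / l^3"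

definition convol :: "(real^3 \<Rightarrow> real) \<Rightarrow> (real^3 \<Rightarrow> real^3) \<Rightarrow> real^3 \<Rightarrow> real^3" where
  "convol k f x = (\<integral>y. k (x - y) *\<^sub>R f y \<partial>lebesgue)"

definition U_filt :: "(real^3 \<Rightarrow> real) \<Rightarrow> real \<Rightarrow> ((real^3) \<times> real \<Rightarrow> real^3)
    \<Rightarrow> (real^3) \<times> real \<Rightarrow> real^3" where
  "U_filt \<phi> l u = (\<lambda>(x, t). convol (rescale l \<phi>) (\<lambda>y. u (y, t)) x)"

definition Omega :: "(real^3 \<Rightarrow> real) \<Rightarrow> real \<Rightarrow> ((real^3) \<times> real \<Rightarrow> real^3)
    \<Rightarrow> (real^3) \<times> real \<Rightarrow> real^3" where
  "Omega \<phi> l u = (\<lambda>(x, t). curl (\<lambda>y. U_filt \<phi> l u (y, t)) x)"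

definition curl_filter_bound :: "(real^3 \<Rightarrow> real) \<Rightarrow> real \<Rightarrow> bool" where
  "curl_filter_bound \<phi> C \<longleftrightarrow> (\<forall>l>0. \<forall>f\<in>L2.
     Linf_norm (curl (convol (rescale l \<phi>) f)) \<le> ennreal (C * l powr (- 5 / 2) * L2_norm f))"

definition outer :: "real^3 \<Rightarrow> real^3 \<Rightarrow> real^3^3" where
  "outer a b = (\<chi> i j. a $ i * b $ j)"

text \<open>Principal value at the origin, by excision of balls.\<close>

definition pv_integral :: "(real^3 \<Rightarrow> real^3^3) \<Rightarrow> real^3^3" where
  "pv_integral f = Lim (at_right 0) (\<lambda>\<delta>. \<integral>z\<in>{z. \<delta> < norm z}. f z \<partial>lebesgue)"

text \<open>The unit vector \<open>z / |z|\<close> is \<^term>\<open>sgn z\<close>. The parameters are the cutoff, its radius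
  \<open>\<rho> r\<close>, and the vorticity field.\<close>

definition S_near :: "(real^3 \<Rightarrow> real) \<Rightarrow> real \<Rightarrow> ((real^3) \<times> real \<Rightarrow> real^3)
    \<Rightarrow> (real^3) \<times> real \<Rightarrow> real^3^3" where
  "S_near \<theta> \<kappa> \<Omega> = (\<lambda>(x, t). (3 / (8 * pi)) *\<^sub>R pv_integral (\<lambda>z.
     (\<theta> (z /\<^sub>R \<kappa>) / (norm z)^3) *\<^sub>R
       (outer (cross3 (sgn z) (\<Omega> (x - z, t))) (sgn z)
        + outer (sgn z) (cross3 (sgn z) (\<Omega> (x - z, t))))))"

definition C_cutoff :: "(real^3 \<Rightarrow> real) \<Rightarrow> real" where
  "C_cutoff \<theta> = (\<integral>w\<in>ball 0 1. \<theta> w / (norm w)\<^sup>2 \<partial>lebesgue)"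

definition I_int :: "real \<Rightarrow> real \<Rightarrow> real set" where
  "I_int t0 r = {t0 - r\<^sup>2 <..< t0}"

definition Q_cyl :: "real^3 \<Rightarrow> real \<Rightarrow> real \<Rightarrow> ((real^3) \<times> real) set" where
  "Q_cyl x0 t0 r = ball x0 r \<times> I_int t0 r"

text \<open>Integrals of nonnegative functions are taken in \<open>[0, \<infinity>]\<close>, so that no quantity below can
  default to zero for lack of integrability.\<close>

definition V_near :: "real^3 \<Rightarrow> real \<Rightarrow> real \<Rightarrow> real \<Rightarrow> (real^3 \<Rightarrow> real) \<Rightarrow> (real^3 \<Rightarrow> real) \<Rightarrow> real
    \<Rightarrow> ((real^3) \<times> real \<Rightarrow> real^3) \<Rightarrow> ((real^3) \<times> real \<Rightarrow> real) \<Rightarrow> ennreal" where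
  "V_near x0 t0 r \<rho> \<theta> \<phi> l u chi = ennreal r *
     (\<integral>\<^sup>+p\<in>Q_cyl x0 t0 r. ennreal (chi p *
        max 0 ((S_near \<theta> (\<rho> * r) (Omega \<phi> l u) p *v Omega \<phi> l u p) \<bullet> Omega \<phi> l u p)) \<partial>lebesgue)"

definition M_quant :: "real^3 \<Rightarrow> real \<Rightarrow> real \<Rightarrow> real \<Rightarrow> ((real^3) \<times> real \<Rightarrow> real^3) \<Rightarrow> ennreal" where
  "M_quant x0 t0 r \<rho> u = ennreal (1 / r) *
     esssup (lebesgue_on (I_int t0 r))
       (\<lambda>t. \<integral>\<^sup>+x\<in>ball x0 ((1 + 2 * \<rho>) * r). ennreal ((norm (u (x, t)))\<^sup>2) \<partial>lebesgue)"

definition O_quant :: "real^3 \<Rightarrow> real \<Rightarrow> real \<Rightarrow> (real^3 \<Rightarrow> real) \<Rightarrow> real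
    \<Rightarrow> ((real^3) \<times> real \<Rightarrow> real^3) \<Rightarrow> ((real^3) \<times> real \<Rightarrow> real) \<Rightarrow> ennreal" where
  "O_quant x0 t0 r \<phi> l u chi = ennreal (1 / r) *
     (\<integral>\<^sup>+p\<in>Q_cyl x0 t0 r. ennreal (chi p * (norm (Omega \<phi> l u p))\<^sup>2) \<partial>lebesgue)"

definition P_quant :: "real^3 \<Rightarrow> real \<Rightarrow> real \<Rightarrow> real \<Rightarrow> (real^3 \<Rightarrow> real) \<Rightarrow> real
    \<Rightarrow> ((real^3) \<times> real \<Rightarrow> real^3) \<Rightarrow> ennreal" where
  "P_quant x0 t0 r \<rho> \<phi> l u = ennreal r *
     (\<integral>\<^sup>+t\<in>I_int t0 r. (\<integral>\<^sup>+x\<in>ball x0 ((1 + \<rho>) * r).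
        ennreal ((norm (grad (\<lambda>y. Omega \<phi> l u (y, t)) x))\<^sup>2) \<partial>lebesgue) \<partial>lebesgue)"

end

theory Submission
  imports Defs
begin

text \<open>Write \<open>\<omega> = \<Omega>(x)\<close> and \<open>D = \<Omega>(x - z) - \<omega>\<close>. The near-field kernel has mean zero on annuli, so the
  principal value may be taken with \<open>D\<close> in place of \<open>\<Omega>(x - z)\<close> and becomes an absolutely convergent
  integral. Its quadratic form at \<open>\<omega>\<close> is at most
  \<open>2 |\<omega>|\<^sup>2 |D| \<theta>(z / \<kappa>) / |z|\<^sup>3\<close> with \<open>\<kappa> = \<rho> r\<close>, and \<open>|D|\<close> is at most \<open>|z|\<close> times the average of
  \<open>|\<nabla>\<Omega>|\<close> over the segment from \<open>x\<close> to \<open>x - z\<close>. Young's inequality inside the integral,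
  with respect to the weight \<open>\<theta>(z / \<kappa>) / |z|\<^sup>2\<close> of total mass \<open>\<kappa> C\<^sub>\<theta>\<close>, leaves a term in \<open>|\<nabla>\<Omega>|\<^sup>2\<close>,
  which Tonelli's theorem bounds by the integral over the enlarged ball, and a term in
  \<open>\<chi> |\<omega>|\<^sup>4\<close>. In the latter two powers are absorbed by the filter bound, applied to \<open>u\<close> cut off to the
  ball of radius \<open>(1 + 2 \<rho>) r\<close>, outside of which \<open>u\<close> does not influence \<open>\<Omega>\<close> on \<open>B\<^sub>r\<close> because \<open>\<ell> \<le> \<rho> r\<close>.\<close>

section \<open>Convolution with test functions\<close>

text \<open>The gradient term must end with coefficient exactly 1 - \<epsilon>, so no constant may
  be lost on it: the derivative is bounded by the Frobenius norm with constant 1, and Young's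
  parameter is taken inversely proportional to the mass \<open>\<kappa> * C_cutoff \<theta>\<close>,
  which then cancels. The quartic term receives this mass twice, once from the weight and once from
  the inverse parameter, and likewise the prefactor \<open>3 / (8 * pi)\<close> twice; this is the
  origin of \<open>9 / (64 * pi\<^sup>2 * (1 - \<epsilon>))\<close> and of
  \<open>\<rho>\<^sup>2\<close>. The obstacle is measurability. The field u is only Lebesgue
  measurable, while the strain at (x, t) sees the whole slice at time t. Tonelli's theorem is
  therefore applied to a Borel field with square integrable slices, whose vorticity agrees with that
  of u at every x for almost every t in the time interval. The mean-zero property is obtained from a
  symmetry of Lebesgue measure and polarisation, without spherical integrals.\<close>

definition dird :: "'a::euclidean_space \<Rightarrow> ('a \<Rightarrow> real) \<Rightarrow> 'a \<Rightarrow> real" where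
  "dird v k x = frechet_derivative k (at x) v"

text \<open>Smooth functions of compact support, with the support condition as vanishing outside a
  ball: this passes to derivatives and dilations without computing closures.\<close>

definition test_fun :: "('a::euclidean_space \<Rightarrow> real) \<Rightarrow> bool" where
  "test_fun k \<longleftrightarrow> (\<forall>n. Ck n k) \<and> (\<exists>R. \<forall>x. R \<le> norm x \<longrightarrow> k x = 0)"

lemma test_fun_differentiable: "test_fun k \<Longrightarrow> k differentiable (at x)"
  unfolding test_fun_def by (metis Ck.simps(2))

lemma test_fun_has_derivative:
  assumes "test_fun k"
  shows "(k has_derivative (\<lambda>h. dird h k x)) (at x within S)"
proof -
  have "(\<lambda>h. dird h k x) = frechet_derivative k (at x)"
    by (simp add: dird_def fun_eq_iff)
  then show ?thesis
    using frechet_derivative_works test_fun_differentiable[OF assms]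
    by (metis has_derivative_at_withinI)
qed

lemma test_fun_continuous: "test_fun k \<Longrightarrow> continuous_on S k"
  by (meson continuous_at_imp_continuous_on differentiable_imp_continuous_within
      test_fun_differentiable)

lemma test_fun_measurable: "test_fun k \<Longrightarrow> k \<in> borel_measurable borel"
  by (intro borel_measurable_continuous_onI test_fun_continuous)

lemma test_fun_linear: "test_fun k \<Longrightarrow> linear (\<lambda>h. dird h k x)"
  using test_fun_has_derivative[of k x UNIV] has_derivative_linear by blast

lemma dird_eq_0:
  assumes "open S" "x \<in> S" "\<And>y. y \<in> S \<Longrightarrow> k y = 0"
  shows "dird v k x = 0"
proof -
  have "((\<lambda>_. 0::real) has_derivative (\<lambda>_. 0)) (at x)" by simp
  then have "(k has_derivative (\<lambda>_. 0)) (at x)"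
    by (rule has_derivative_transform_within_open[OF _ assms(1,2)]) (simp add: assms(3))
  then show ?thesis
    unfolding dird_def by (metis frechet_derivative_at)
qed

text \<open>The strict inequality leaves an open neighbourhood on which k vanishes, so its
  derivative vanishes by locality.\<close>

lemma dird_support:
  assumes "\<And>x. R \<le> norm x \<Longrightarrow> k x = 0" "R < norm x"
  shows "dird v k x = 0"
proof (rule dird_eq_0)
  show "open {x::'a. R < norm x}"
    by (intro open_Collect_less continuous_intros)
qed (use assms in auto)

lemma test_fun_dird:
  assumes "test_fun k" shows "test_fun (dird v k)"
proof -
  obtain R where R: "\<And>x. R \<le> norm x \<Longrightarrow> k x = 0"
    using assms unfolding test_fun_def by blast
  have "Ck n (dird v k)" for n
  proof -
    have "Ck (Suc n) k" using assms unfolding test_fun_def by blast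
    then show ?thesis unfolding dird_def[abs_def] by simp
  qed
  \<comment> \<open>Enlarging the radius by 1 restores the non-strict form demanded by
    \<open>test_fun\<close>.\<close>
  moreover have "dird v k x = 0" if "R + 1 \<le> norm x" for x
    by (rule dird_support[of R]) (use R that in auto)
  ultimately show ?thesis unfolding test_fun_def by blast
qed

lemma test_fun_bounded:
  assumes "test_fun k"
  obtains B where "B > 0" "\<And>x. \<bar>k x\<bar> \<le> B"
proof -
  obtain R where R: "\<And>x. R \<le> norm x \<Longrightarrow> k x = 0"
    using assms unfolding test_fun_def by blast
  have "compact (k ` cball 0 R)"
    by (intro compact_continuous_image test_fun_continuous assms compact_cball)
  then obtain B where B: "B > 0" "\<And>x. x \<in> cball 0 R \<Longrightarrow> \<bar>k x\<bar> \<le> B"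
    using compact_imp_bounded bounded_pos by (metis imageI real_norm_def)
  have "\<bar>k x\<bar> \<le> B" for x
    using B R[of x] by (cases "norm x \<le> R") auto
  with B that show ?thesis by blast
qed

lemma test_fun_uniformly_continuous:
  assumes "test_fun k" "e > 0"
  obtains d where "d > 0" "\<And>x y. dist x y < d \<Longrightarrow> \<bar>k x - k y\<bar> < e"
proof -
  obtain R where R: "\<And>x. R \<le> norm x \<Longrightarrow> k x = 0"
    using assms unfolding test_fun_def by blast
  have "uniformly_continuous_on (cball 0 (R + 1)) k"
    by (intro compact_uniformly_continuous test_fun_continuous assms compact_cball)
  then obtain d where d: "d > 0"
    "\<And>x y. x \<in> cball 0 (R+1) \<Longrightarrow> y \<in> cball 0 (R+1) \<Longrightarrow> dist x y < d \<Longrightarrow> \<bar>k x - k y\<bar> < e"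
    using \<open>e > 0\<close> unfolding uniformly_continuous_on_def dist_real_def by metis
  show thesis
  proof
    show "min d 1 > 0" using d by simp
    fix x y :: 'a assume xy: "dist x y < min d 1"
    have n: "norm x \<le> norm y + dist x y" "norm y \<le> norm x + dist x y"
      using norm_triangle_sub[of x y] norm_triangle_sub[of y x]
      by (auto simp: dist_norm norm_minus_commute)
    show "\<bar>k x - k y\<bar> < e"
    proof (cases "norm x \<le> R + 1 \<and> norm y \<le> R + 1")
      case True then show ?thesis using d xy by simp
    next
      case False
      \<comment> \<open>One of the points is farther than R + 1 from the origin and their distance
        is below 1, so both lie where k vanishes.\<close>
      then have "R \<le> norm x" "R \<le> norm y" using n xy by auto
      then show ?thesis using R \<open>e > 0\<close> by simp
    qed
  qed
qed

lemma dird_sum_Basis: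
  assumes "test_fun k"
  shows "dird h k x = (\<Sum>b\<in>Basis. (h \<bullet> b) * dird b k x)"
proof -
  interpret linear "\<lambda>h. dird h k x" by (rule test_fun_linear[OF assms])
  have "dird h k x = dird (\<Sum>b\<in>Basis. (h \<bullet> b) *\<^sub>R b) k x" by (simp add: euclidean_representation)
  also have "\<dots> = (\<Sum>b\<in>Basis. (h \<bullet> b) * dird b k x)" by (simp add: sum scale)
  finally show ?thesis .
qed

text \<open>The remainder is uniform in z, because the finitely many partial derivatives are
  uniformly continuous. This uniformity is what lets a convolution with a merely locally integrable
  function be differentiated.\<close>

lemma test_fun_taylor:
  fixes k :: "'a::euclidean_space \<Rightarrow> real"
  assumes k: "test_fun k" and e: "e > 0"
  obtains d where "d > 0"
    "\<And>z h. norm h < d \<Longrightarrow> \<bar>k (z + h) - k z - dird h k z\<bar> \<le> e * norm h"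
proof -
  \<comment> \<open>The derivative is a sum over the basis; each of the DIM('a) coordinates may
    contribute e / DIM('a) to the operator norm.\<close>
  define e' where "e' = e / DIM('a)"
  have e': "e' > 0" using e by (simp add: e'_def)
  have "\<exists>d>0. \<forall>x y. dist x y < d \<longrightarrow> \<bar>dird b k x - dird b k y\<bar> < e'" for b :: 'a
    using test_fun_uniformly_continuous[OF test_fun_dird[OF k] e'] by metis
  then obtain D where D: "\<And>b::'a. D b > 0"
    "\<And>b x y. dist x y < D b \<Longrightarrow> \<bar>dird b k x - dird b k y\<bar> < e'"
    by metis
  define d where "d = Min (D ` Basis)"
  have d: "d > 0" "\<And>b. b \<in> Basis \<Longrightarrow> d \<le> D b"
    using D by (auto simp: d_def)
  show thesis
  proof
    show "d > 0" by fact
    fix z h :: 'a assume h: "norm h < d"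
    have "norm (k (z+h) - k z - (\<lambda>h. dird h k z) ((z+h) - z)) \<le> norm ((z+h) - z) * e"
    proof (rule differentiable_bound_linearization[where S="ball z d" and f'="\<lambda>w h. dird h k w"])
      show "z + t *\<^sub>R (z + h - z) \<in> ball z d" if "t \<in> {0..1}" for t
      proof -
        have "\<bar>t\<bar> * norm h \<le> 1 * norm h" using that by (intro mult_right_mono) auto
        then show ?thesis using h by (simp add: dist_norm)
      qed
      show "(k has_derivative (\<lambda>h. dird h k w)) (at w within ball z d)" for w
        by (rule test_fun_has_derivative[OF k])
      show "z \<in> ball z d" using d by simp
      show "onorm ((\<lambda>h. dird h k w) - (\<lambda>h. dird h k z)) \<le> e" if w: "w \<in> ball z d" for w
      proof (rule onorm_bound)
        show "0 \<le> e" using e by simp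
        fix v :: 'a
        have "norm (((\<lambda>h. dird h k w) - (\<lambda>h. dird h k z)) v)
            = \<bar>\<Sum>b\<in>Basis. (v \<bullet> b) * (dird b k w - dird b k z)\<bar>"
          by (simp add: dird_sum_Basis[OF k, of v] sum_subtractf algebra_simps)
        also have "\<dots> \<le> (\<Sum>b\<in>Basis. \<bar>(v \<bullet> b) * (dird b k w - dird b k z)\<bar>)"
          by (rule sum_abs)
        also have "\<dots> \<le> (\<Sum>b\<in>(Basis::'a set). norm v * e')"
        proof (rule sum_mono)
          fix b :: 'a assume b: "b \<in> Basis"
          have "\<bar>dird b k w - dird b k z\<bar> \<le> e'"
            using D(2)[of w z b] d(2)[OF b] w by (simp add: dist_commute)
          then show "\<bar>(v \<bullet> b) * (dird b k w - dird b k z)\<bar> \<le> norm v * e'"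
            unfolding abs_mult using Basis_le_norm[OF b, of v] by (intro mult_mono) auto
        qed
        also have "\<dots> = e * norm v" by (simp add: e'_def)
        finally show "norm (((\<lambda>h. dird h k w) - (\<lambda>h. dird h k z)) v) \<le> e * norm v" .
      qed
    qed
    then show "\<bar>k (z + h) - k z - dird h k z\<bar> \<le> e * norm h" by (simp add: mult.commute)
  qed
qed

lemma dird_scale:
  assumes "k differentiable (at (a *\<^sub>R x))"
  shows "frechet_derivative (\<lambda>x. c * k (a *\<^sub>R x)) (at x) = (\<lambda>v. (c * a) * dird v k (a *\<^sub>R x))"
    and "(\<lambda>x. c * k (a *\<^sub>R x)) differentiable (at x)"
proof -
  have k: "(k has_derivative frechet_derivative k (at (a *\<^sub>R x))) (at (a *\<^sub>R x))"
    using assms frechet_derivative_works by blast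
  have "((\<lambda>x. c * k (a *\<^sub>R x)) has_derivative
      (\<lambda>v. c * frechet_derivative k (at (a *\<^sub>R x)) (a *\<^sub>R v))) (at x)"
    by (intro has_derivative_mult_right has_derivative_compose[where f="\<lambda>x. a *\<^sub>R x", OF _ k])
       (auto intro!: derivative_eq_intros)
  moreover have "(\<lambda>v. c * frechet_derivative k (at (a *\<^sub>R x)) (a *\<^sub>R v)) = (\<lambda>v. (c * a) * dird v k (a *\<^sub>R x))"
    using linear_scale[OF linear_frechet_derivative[OF assms]] by (simp add: dird_def fun_eq_iff)
  ultimately have *: "((\<lambda>x. c * k (a *\<^sub>R x)) has_derivative (\<lambda>v. (c * a) * dird v k (a *\<^sub>R x))) (at x)"
    by simp
  then show "frechet_derivative (\<lambda>x. c * k (a *\<^sub>R x)) (at x) = (\<lambda>v. (c * a) * dird v k (a *\<^sub>R x))"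
    by (metis frechet_derivative_at)
  show "(\<lambda>x. c * k (a *\<^sub>R x)) differentiable (at x)"
    using * differentiable_def by blast
qed

text \<open>A derivative of a dilated function is the dilation of a derivative with prefactor
  \<open>c * a\<close>, so the induction must vary both the function and the prefactor.\<close>

lemma Ck_scale: "Ck n k \<Longrightarrow> Ck n (\<lambda>x. c * k (a *\<^sub>R x))"
proof (induction n arbitrary: k c)
  case 0
  then have "continuous_on UNIV k" by simp
  then have "continuous_on UNIV (\<lambda>x. k (a *\<^sub>R x))"
    by (rule continuous_on_compose2[where f="\<lambda>x. a *\<^sub>R x"])
       (simp_all add: continuous_on_scaleR)
  then show ?case by (simp add: continuous_on_mult_left)
next
  case (Suc n)
  then have d: "\<And>x. k differentiable (at x)" by simp
  have "Ck n (dird v k)" for v using Suc.prems by (simp add: dird_def[abs_def])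
  then have "Ck n (\<lambda>x. frechet_derivative (\<lambda>x. c * k (a *\<^sub>R x)) (at x) v)" for v
    using Suc.IH[of "dird v k" "c * a"] by (simp only: dird_scale(1)[OF d])
  then show ?case using dird_scale(2)[OF d] by (simp only: Ck.simps) blast
qed

lemma Cc_infty_ball_support:
  assumes "f \<in> Cc_infty (ball 0 R)" "R \<le> norm x"
  shows "f x = 0"
proof (rule ccontr)
  assume "f x \<noteq> 0"
  then have "x \<in> ball 0 R" using assms(1) closure_subset[of "{x. f x \<noteq> 0}"] unfolding Cc_infty_def by blast
  then show False using assms(2) by simp
qed

lemma Cc_infty_ball_test_fun:
  assumes "f \<in> Cc_infty (ball 0 R)" shows "test_fun f"
  unfolding test_fun_def
proof
  show "\<forall>n. Ck n f" using assms unfolding Cc_infty_def by blast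
  show "\<exists>R. \<forall>x. R \<le> norm x \<longrightarrow> f x = 0" using Cc_infty_ball_support[OF assms] by blast
qed

lemma rescale_support:
  assumes "\<phi> \<in> Cc_infty (ball 0 1)" "l > 0" "l \<le> norm x"
  shows "rescale l \<phi> x = 0"
proof -
  have "1 \<le> norm (x /\<^sub>R l)" using assms by (simp add: divide_inverse_commute[symmetric])
  then show ?thesis by (simp add: rescale_def Cc_infty_ball_support[OF assms(1)])
qed

lemma test_fun_rescale:
  assumes "\<phi> \<in> Cc_infty (ball 0 1)" "l > 0"
  shows "test_fun (rescale l \<phi>)"
proof -
  have eq: "rescale l \<phi> = (\<lambda>x. (1 / l^3) * \<phi> ((1 / l) *\<^sub>R x))"
    by (simp add: rescale_def fun_eq_iff inverse_eq_divide)
  have "Ck n (rescale l \<phi>)" for n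
    unfolding eq by (rule Ck_scale) (use assms in \<open>auto simp: Cc_infty_def\<close>)
  then show ?thesis
    unfolding test_fun_def using rescale_support[OF assms] by blast
qed

text \<open>Borel rather than Lebesgue measurability is required, so that convolution integrands are
  Borel and their integrals can be taken over \<open>lborel\<close>.\<close>

definition loc_int :: "('a::euclidean_space \<Rightarrow> 'b::euclidean_space) \<Rightarrow> bool" where
  "loc_int f \<longleftrightarrow> f \<in> borel_measurable borel \<and> (\<forall>R. set_integrable lborel (cball 0 R) f)"

lemma loc_int_measurable [measurable_dest]: "loc_int f \<Longrightarrow> f \<in> borel_measurable borel"
  by (simp add: loc_int_def)

lemma conv_integrable:
  fixes f :: "'a::euclidean_space \<Rightarrow> 'b::euclidean_space"
  assumes k: "test_fun k" and f: "loc_int f"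
  shows "integrable lborel (\<lambda>y. k (x - y) *\<^sub>R f y)"
proof -
  obtain R where R: "\<And>x. R \<le> norm x \<Longrightarrow> k x = 0"
    using k unfolding test_fun_def by blast
  obtain B where B: "B > 0" "\<And>x. \<bar>k x\<bar> \<le> B" using test_fun_bounded[OF k] by metis
  have [measurable]: "f \<in> borel_measurable borel" "k \<in> borel_measurable borel"
    using f k by (auto intro: loc_int_measurable test_fun_measurable)
  have "set_integrable lborel (cball 0 (R + norm x)) f" using f by (simp add: loc_int_def)
  then have "integrable lborel (\<lambda>y. B *\<^sub>R (indicator (cball 0 (R + norm x)) y *\<^sub>R f y))"
    unfolding set_integrable_def by (rule integrable_scaleR_right)
  then show ?thesis
  proof (rule Bochner_Integration.integrable_bound)
    show "AE y in lborel. norm (k (x - y) *\<^sub>R f y)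
        \<le> norm (B *\<^sub>R (indicator (cball 0 (R + norm x)) y *\<^sub>R f y))"
    proof (rule AE_I2)
      fix y
      show "norm (k (x - y) *\<^sub>R f y) \<le> norm (B *\<^sub>R (indicator (cball 0 (R + norm x)) y *\<^sub>R f y))"
      proof (cases "R \<le> norm (x - y)")
        case True then show ?thesis using R by simp
      next
        case False
        then have "norm y \<le> R + norm x"
          using norm_triangle_ineq4[of x "x - y"] by simp
        then show ?thesis using B by (auto intro!: mult_right_mono)
      qed
    qed
  qed simp
qed

lemma convol_lborel:
  assumes "test_fun k" "f \<in> borel_measurable borel"
  shows "convol k f x = (\<integral>y. k (x - y) *\<^sub>R f y \<partial>lborel)"
proof -
  have [measurable]: "f \<in> borel_measurable borel" "k \<in> borel_measurable borel"
    using assms by (auto intro: loc_int_measurable test_fun_measurable)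
  show ?thesis
    unfolding convol_def by (rule integral_completion) simp
qed

lemma convol_linear:
  assumes k: "test_fun k" and f: "loc_int f"
  shows "linear (\<lambda>h. convol (dird h k) f x)"
proof -
  have eq: "convol (dird h k) f x = (\<integral>y. dird h k (x - y) *\<^sub>R f y \<partial>lborel)" for h
    by (rule convol_lborel) (use f in \<open>auto intro: test_fun_dird[OF k] loc_int_measurable\<close>)
  note int = conv_integrable[OF test_fun_dird[OF k] f]
  note lin = test_fun_linear[OF k]
  show ?thesis
  proof
    fix a b
    have "convol (dird (a + b) k) f x
        = (\<integral>y. dird a k (x - y) *\<^sub>R f y + dird b k (x - y) *\<^sub>R f y \<partial>lborel)"
      unfolding eq by (simp add: linear_add[OF lin] scaleR_add_left)
    also have "\<dots> = convol (dird a k) f x + convol (dird b k) f x"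
      unfolding eq by (rule Bochner_Integration.integral_add[OF int int])
    finally show "convol (dird (a + b) k) f x = convol (dird a k) f x + convol (dird b k) f x" .
  next
    fix c :: real and a
    have "convol (dird (c *\<^sub>R a) k) f x = (\<integral>y. c *\<^sub>R (dird a k (x - y) *\<^sub>R f y) \<partial>lborel)"
      unfolding eq by (simp add: linear_scale[OF lin])
    also have "\<dots> = c *\<^sub>R convol (dird a k) f x"
      unfolding eq by (rule integral_scaleR_right)
    finally show "convol (dird (c *\<^sub>R a) k) f x = c *\<^sub>R convol (dird a k) f x" .
  qed
qed

text \<open>All derivatives fall on the kernel. The uniform Taylor remainder bounds the error by a
  small multiple of \<open>norm h\<close> times the integral of |f| over one fixed ball.\<close>

lemma convol_has_derivative:
  assumes k: "test_fun k" and f: "loc_int f"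
  shows "(convol k f has_derivative (\<lambda>h. convol (dird h k) f x)) (at x)"
  unfolding has_derivative_at_alt
proof (intro conjI allI impI)
  show "bounded_linear (\<lambda>h. convol (dird h k) f x)"
    using convol_linear[OF k f] by (simp add: linear_conv_bounded_linear)
  fix e :: real assume e: "e > 0"
  obtain R where R: "\<And>x. R \<le> norm x \<Longrightarrow> k x = 0"
    using k unfolding test_fun_def by blast
  \<comment> \<open>The extra 1 makes one ball contain every y at which \<open>k (x - y)\<close>,
    its derivative or \<open>k (x - y + h)\<close> is nonzero, for all h with
    \<open>norm h < 1\<close>.\<close>
  define X where "X = cball (0::real^3) (R + norm x + 1)"
  have X: "integrable lborel (\<lambda>y. indicator X y *\<^sub>R f y)"
    using f unfolding loc_int_def X_def set_integrable_def by blast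
  define A where "A = (\<integral>y. norm (indicator X y *\<^sub>R f y) \<partial>lborel)"
  have A: "A \<ge> 0" unfolding A_def by (intro integral_nonneg_AE) auto
  \<comment> \<open>A may be 0, hence A + 1 in the denominator.\<close>
  define e' where "e' = e / (A + 1)"
  have e': "e' > 0" "e' * A \<le> e" using e A by (auto simp: e'_def field_simps)
  obtain d where d: "d > 0"
    "\<And>z h. norm h < d \<Longrightarrow> \<bar>k (z + h) - k z - dird h k z\<bar> \<le> e' * norm h"
    using test_fun_taylor[OF k e'(1)] by metis
  show "\<exists>d>0. \<forall>y. norm (y - x) < d \<longrightarrow>
      norm (convol k f y - convol k f x - convol (dird (y - x) k) f x) \<le> e * norm (y - x)"
  proof (intro exI[of _ "min d 1"] conjI allI impI)
    show "min d 1 > 0" using d by simp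
    fix x' assume x': "norm (x' - x) < min d 1"
    define h where "h = x' - x"
    have h: "norm h < d" "norm h < 1" "x' = x + h" using x' by (auto simp: h_def)
    note fm = loc_int_measurable[OF f]
    note int = conv_integrable[OF k f] conv_integrable[OF test_fun_dird[OF k] f]
    have "convol k f x' - convol k f x - convol (dird h k) f x
       = (\<integral>y. k (x' - y) *\<^sub>R f y - k (x - y) *\<^sub>R f y - dird h k (x - y) *\<^sub>R f y \<partial>lborel)"
      by (simp add: convol_lborel k fm test_fun_dird int)
    also have "\<dots> = (\<integral>y. (k (x - y + h) - k (x - y) - dird h k (x - y)) *\<^sub>R f y \<partial>lborel)"
      by (simp add: h(3) algebra_simps)
    also have "norm \<dots> \<le> (\<integral>y. (e' * norm h) * norm (indicator X y *\<^sub>R f y) \<partial>lborel)"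
    proof (rule Bochner_Integration.integral_norm_bound_integral)
      have "integrable lborel (\<lambda>y. k (x' - y) *\<^sub>R f y - k (x - y) *\<^sub>R f y - dird h k (x - y) *\<^sub>R f y)"
        by (intro Bochner_Integration.integrable_diff int)
      then show "integrable lborel (\<lambda>y. (k (x - y + h) - k (x - y) - dird h k (x - y)) *\<^sub>R f y)"
        by (simp add: h(3) algebra_simps)
      show "integrable lborel (\<lambda>y. (e' * norm h) * norm (indicator X y *\<^sub>R f y))"
        by (intro integrable_mult_right integrable_norm X)
      fix y
      show "norm ((k (x - y + h) - k (x - y) - dird h k (x - y)) *\<^sub>R f y)
          \<le> (e' * norm h) * norm (indicator X y *\<^sub>R f y)"
      proof (cases "y \<in> X")
        case True
        then show ?thesis using d(2)[OF h(1), of "x - y"]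
          by (auto intro!: mult_right_mono)
      next
        case False
        then have "norm y > R + norm x + 1" by (simp add: X_def)
        then have n: "norm (x - y) > R + 1"
          using norm_triangle_ineq2[of y x] by (simp add: norm_minus_commute)
        then have "norm (x - y + h) \<ge> R"
          using norm_triangle_ineq2[of "x - y" "- h"] h(2) by simp
        then show ?thesis using R n dird_support[of R k "x - y" h, OF R] e'(1) by simp
      qed
    qed
    also have "\<dots> = (e' * A) * norm h" by (simp add: A_def)
    also have "\<dots> \<le> e * norm h" using e' by (intro mult_right_mono) auto
    finally show "norm (convol k f x' - convol k f x - convol (dird (x' - x) k) f x) \<le> e * norm (x' - x)"
      unfolding h_def .
  qed
qed

lemma convol_continuous: "test_fun k \<Longrightarrow> loc_int f \<Longrightarrow> continuous_on S (convol k f)"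
  by (intro continuous_at_imp_continuous_on ballI has_derivative_continuous[OF convol_has_derivative])

section \<open>The filtered vorticity\<close>

text \<open>Cauchy-Schwarz in each row: the operator norm is at most the Frobenius norm. The
  constant 1 survives into the coefficient of the gradient term.\<close>

lemma norm_linear_le_matrix:
  fixes A :: "real^'n \<Rightarrow> real^'m"
  assumes "linear A"
  shows "norm (A h) \<le> norm (matrix A) * norm h"
proof -
  have "A h = matrix A *v h"
    using matrix_vector_mul(2)[OF assms] by metis
  then have "norm (A h) = L2_set (\<lambda>i. \<bar>(matrix A) $ i \<bullet> h\<bar>) UNIV"
    by (simp add: matrix_vector_mul_component norm_vec_def)
  also have "\<dots> \<le> L2_set (\<lambda>i. norm ((matrix A) $ i) * norm h) UNIV"
    by (intro L2_set_mono Cauchy_Schwarz_ineq2 abs_ge_zero)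
  also have "\<dots> = norm (matrix A) * norm h"
    by (simp add: L2_set_left_distrib norm_vec_def)
  finally show ?thesis .
qed

text \<open>Expresses the Frobenius norm through directional derivatives, from which continuity and
  joint measurability of the gradient norm are read off.\<close>

lemma norm_matrix_columns:
  fixes A :: "real^'n \<Rightarrow> real^'m"
  shows "(norm (matrix A))\<^sup>2 = (\<Sum>b\<in>UNIV. (norm (A (axis b 1)))\<^sup>2)"
proof -
  have sq: "(norm v)\<^sup>2 = (\<Sum>i\<in>UNIV. (v $ i)\<^sup>2)" for v :: "real^'k"
    unfolding norm_vec_def L2_set_def by (simp add: sum_nonneg)
  have "(norm (matrix A))\<^sup>2 = (\<Sum>i\<in>UNIV. (norm (matrix A $ i))\<^sup>2)"
    unfolding norm_vec_def[of "matrix A"] L2_set_def by (simp add: sum_nonneg)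
  also have "\<dots> = (\<Sum>i\<in>UNIV. \<Sum>b\<in>UNIV. (A (axis b 1) $ i)\<^sup>2)"
    by (simp add: sq matrix_def)
  also have "\<dots> = (\<Sum>b\<in>UNIV. (norm (A (axis b 1)))\<^sup>2)"
    unfolding sq by (rule sum.swap)
  finally show ?thesis .
qed

lemma bounded_linear_cross3: "bounded_linear (cross3 a)"
proof -
  have "linear (cross3 a)"
    by (intro linearI) (simp_all add: cross3_simps)
  then show ?thesis by (simp add: linear_conv_bounded_linear)
qed

lemma norm_cross3_le: "norm (cross3 a b) \<le> norm a * norm b"
proof (rule power2_le_imp_le)
  show "(norm (cross3 a b))\<^sup>2 \<le> (norm a * norm b)\<^sup>2"
    by (simp add: norm_cross power_mult_distrib)
qed simp

text \<open>The curl of the filtered field, written as the sum of \<open>axis i 1\<close> crossed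
  with the i-th partial derivative and with the derivatives moved onto the kernel. Only convolutions
  remain, so its measurability and locality reduce to theirs.\<close>

definition vort :: "(real^3 \<Rightarrow> real) \<Rightarrow> (real^3 \<Rightarrow> real^3) \<Rightarrow> real^3 \<Rightarrow> real^3" where
  "vort k f x = (\<Sum>i\<in>UNIV. cross3 (axis i 1) (convol (dird (axis i 1) k) f x))"

definition dvort :: "(real^3 \<Rightarrow> real) \<Rightarrow> (real^3 \<Rightarrow> real^3) \<Rightarrow> real^3 \<Rightarrow> real^3 \<Rightarrow> real^3" where
  "dvort k f x h = (\<Sum>i\<in>UNIV. cross3 (axis i 1) (convol (dird h (dird (axis i 1) k)) f x))"

lemma curl_convol:
  assumes "test_fun k" "loc_int f"
  shows "curl (convol k f) = vort k f"
proof
  fix x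
  have "partial i (convol k f) x = convol (dird (axis i 1) k) f x" for i
    unfolding partial_def
    using frechet_derivative_at[OF convol_has_derivative[OF assms, of x]] by metis
  then show "curl (convol k f) x = vort k f x"
    by (simp add: curl_def vort_def vec_eq_iff forall_3 sum_3 cross3_def axis_def)
qed

lemma vort_has_derivative:
  assumes "test_fun k" "loc_int f"
  shows "(vort k f has_derivative dvort k f x) (at x)"
  unfolding vort_def[abs_def] dvort_def[abs_def]
  by (intro has_derivative_sum bounded_linear.has_derivative[OF bounded_linear_cross3]
      convol_has_derivative test_fun_dird assms)

lemma dvort_linear: "test_fun k \<Longrightarrow> loc_int f \<Longrightarrow> linear (dvort k f x)"
  using vort_has_derivative has_derivative_linear by blast

lemma vort_continuous: "test_fun k \<Longrightarrow> loc_int f \<Longrightarrow> continuous_on S (vort k f)"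
  by (intro continuous_at_imp_continuous_on ballI has_derivative_continuous[OF vort_has_derivative])

lemma dvort_continuous: "test_fun k \<Longrightarrow> loc_int f \<Longrightarrow> continuous_on S (\<lambda>x. dvort k f x h)"
  unfolding dvort_def
  by (intro continuous_intros bounded_linear.continuous_on[OF bounded_linear_cross3]
      convol_continuous test_fun_dird)

lemma grad_vort:
  assumes "test_fun k" "loc_int f"
  shows "grad (vort k f) x = matrix (dvort k f x)"
  unfolding grad_def using frechet_derivative_at[OF vort_has_derivative[OF assms, of x]] by simp

lemma norm_dvort_le:
  assumes "test_fun k" "loc_int f"
  shows "norm (dvort k f x h) \<le> norm (grad (vort k f) x) * norm h"
  unfolding grad_vort[OF assms] by (rule norm_linear_le_matrix[OF dvort_linear[OF assms]])

lemma grad_vort_norm: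
  assumes "test_fun k" "loc_int f"
  shows "(norm (grad (vort k f) x))\<^sup>2 = (\<Sum>b\<in>UNIV. (norm (dvort k f x (axis b 1)))\<^sup>2)"
  unfolding grad_vort[OF assms] by (rule norm_matrix_columns)

lemma continuous_norm_grad_vort:
  assumes "test_fun k" "loc_int f"
  shows "continuous_on S (\<lambda>x. norm (grad (vort k f) x))"
proof -
  have "norm (grad (vort k f) x) = sqrt (\<Sum>b\<in>UNIV. (norm (dvort k f x (axis b 1)))\<^sup>2)" for x
    by (simp add: grad_vort_norm[OF assms, symmetric])
  then show ?thesis
    by (simp only:) (intro continuous_intros dvort_continuous assms)
qed

section \<open>Locality of the filter and the pointwise vorticity bound\<close>

lemma L2_loc_int:
  fixes f :: "'a::euclidean_space \<Rightarrow> 'b::euclidean_space"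
  assumes [measurable]: "f \<in> borel_measurable borel" and fin: "(\<integral>\<^sup>+x. ennreal ((norm (f x))\<^sup>2) \<partial>lborel) < \<infinity>"
  shows "loc_int f"
  unfolding loc_int_def
proof (intro conjI allI)
  fix R
  have sq: "integrable lborel (\<lambda>x. (norm (f x))\<^sup>2)"
    by (rule integrableI_bounded) (use fin in auto)
  have "integrable lborel (\<lambda>x. indicator (cball 0 R) x + (norm (f x))\<^sup>2 :: real)"
    by (intro Bochner_Integration.integrable_add sq integrable_real_indicator)
       (use emeasure_lborel_cball_finite[of "0::'a" R] in auto)
  then show "set_integrable lborel (cball 0 R) f"
    unfolding set_integrable_def
  proof (rule Bochner_Integration.integrable_bound)
    show "AE x in lborel. norm (indicator (cball 0 R) x *\<^sub>R f x)
        \<le> norm (indicator (cball 0 R) x + (norm (f x))\<^sup>2 :: real)"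
    proof (rule AE_I2)
      fix x
      have "2 * norm (f x) \<le> 1 + (norm (f x))\<^sup>2"
        using sum_squares_bound[of 1 "norm (f x)"] by simp
      moreover have "0 \<le> norm (f x)" by simp
      ultimately have "norm (f x) \<le> 1 + (norm (f x))\<^sup>2" by linarith
      then show "norm (indicator (cball 0 R) x *\<^sub>R f x)
        \<le> norm (indicator (cball 0 R) x + (norm (f x))\<^sup>2 :: real)"
        by (auto simp: indicator_def)
    qed
    have [measurable]: "cball (0::'a) R \<in> sets borel" by simp
    show "(\<lambda>x. indicator (cball 0 R) x *\<^sub>R f x) \<in> borel_measurable lborel" by measurable
  qed
qed simp

lemma convol_local:
  assumes k: "test_fun k" "\<And>z. l < norm z \<Longrightarrow> k z = 0"
    and S: "cball x l \<subseteq> S"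
  shows "convol k (\<lambda>y. indicator S y *\<^sub>R f y) x = convol k f x"
  unfolding convol_def
proof (rule Bochner_Integration.integral_cong[OF refl])
  fix y
  show "k (x - y) *\<^sub>R indicator S y *\<^sub>R f y = k (x - y) *\<^sub>R f y"
  proof (cases "y \<in> S")
    case False
    then have "y \<notin> cball x l" using S by blast
    then have "l < norm (x - y)" by (simp add: dist_norm)
    then show ?thesis using k by simp
  qed simp
qed

lemma vort_local:
  assumes "test_fun k" "\<And>z. l \<le> norm z \<Longrightarrow> k z = 0" "cball x l \<subseteq> S"
  shows "vort k (\<lambda>y. indicator S y *\<^sub>R f y) x = vort k f x"
  unfolding vort_def
  by (intro sum.cong refl arg_cong[where f="cross3 _"] convol_local[where l=l] test_fun_dird
      dird_support[where R=l] assms)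

text \<open>The filter bound is applied to f cut off to S, which leaves the vorticity at x
  unchanged. It holds only almost everywhere, but the set on which a continuous function has norm at
  most N is closed, so it holds at every point. Squaring turns the power -5/2 of l into -5.\<close>

lemma vort_pointwise_bound:
  assumes C: "curl_filter_bound \<phi> C" "C > 0" and \<phi>: "\<phi> \<in> Cc_infty (ball 0 1)" and l: "l > 0"
    and f [measurable]: "f \<in> borel_measurable borel"
    and fin: "(\<integral>\<^sup>+x. ennreal ((norm (f x))\<^sup>2) \<partial>lborel) < \<infinity>"
    and S [measurable]: "S \<in> sets borel" and sub: "cball x l \<subseteq> S"
  shows "ennreal ((norm (vort (rescale l \<phi>) f x))\<^sup>2)
    \<le> ennreal (C\<^sup>2 / l ^ 5) * (\<integral>\<^sup>+x. ennreal ((norm (f x))\<^sup>2) * indicator S x \<partial>lborel)"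
proof -
  define g where "g = (\<lambda>y. indicator S y *\<^sub>R f y)"
  have g [measurable]: "g \<in> borel_measurable borel" unfolding g_def by measurable
  have gS: "ennreal ((norm (g x))\<^sup>2) = ennreal ((norm (f x))\<^sup>2) * indicator S x" for x
    by (auto simp: g_def indicator_def)
  have gfin: "(\<integral>\<^sup>+x. ennreal ((norm (g x))\<^sup>2) \<partial>lborel) < \<infinity>"
    by (rule le_less_trans[OF nn_integral_mono fin]) (auto simp: g_def indicator_def)
  have gint: "integrable lborel (\<lambda>x. (norm (g x))\<^sup>2)"
    by (rule integrableI_bounded) (use gfin in auto)
  note loc = L2_loc_int[OF g gfin]
  note k = test_fun_rescale[OF \<phi> l]
  define N where "N = C * l powr (- 5 / 2) * L2_norm g"
  have L2sq: "(L2_norm g)\<^sup>2 = (\<integral>x. (norm (g x))\<^sup>2 \<partial>lborel)"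
    by (simp add: L2_norm_def integral_completion)
  have N: "N \<ge> 0" using C by (simp add: N_def L2_norm_def)
  have gL2: "g \<in> L2"
    unfolding L2_def using gint by (auto intro!: measurable_completion simp: integrable_completion)
  have "Linf_norm (vort (rescale l \<phi>) g) \<le> ennreal N"
    using C(1) gL2 l unfolding curl_filter_bound_def N_def curl_convol[OF k loc, symmetric] by blast
  then have "AE x in lebesgue. ennreal (norm (vort (rescale l \<phi>) g x)) \<le> ennreal N"
    using esssup_AE[of "\<lambda>x. ennreal (norm (vort (rescale l \<phi>) g x))" lebesgue]
    unfolding Linf_norm_def by (auto elim!: eventually_mono)
  then have "AE x in lebesgue. x \<in> {x. norm (vort (rescale l \<phi>) g x) \<le> N}"
    using N by simp
  moreover have "closed {x. norm (vort (rescale l \<phi>) g x) \<le> N}"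
    by (intro closed_Collect_le continuous_intros vort_continuous k loc)
  ultimately have "norm (vort (rescale l \<phi>) g x) \<le> N"
    using mem_closed_if_AE_lebesgue by blast
  moreover have "vort (rescale l \<phi>) g x = vort (rescale l \<phi>) f x"
    unfolding g_def by (rule vort_local[OF k _ sub]) (rule rescale_support[OF \<phi> l])
  ultimately have "(norm (vort (rescale l \<phi>) f x))\<^sup>2 \<le> N\<^sup>2"
    by (intro power_mono) auto
  also have "N\<^sup>2 = (C\<^sup>2 / l ^ 5) * (\<integral>x. (norm (g x))\<^sup>2 \<partial>lborel)"
  proof -
    have "(l powr (- 5 / 2))\<^sup>2 = l powr (- 5)" by (simp add: power2_eq_square powr_add[symmetric])
    also have "\<dots> = 1 / l ^ 5" using l by (simp add: powr_minus powr_numeral inverse_eq_divide)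
    finally show ?thesis by (simp add: N_def power_mult_distrib L2sq)
  qed
  finally have "ennreal ((norm (vort (rescale l \<phi>) f x))\<^sup>2) \<le> ennreal ((C\<^sup>2 / l ^ 5) * (\<integral>x. (norm (g x))\<^sup>2 \<partial>lborel))"
    by (rule ennreal_leI)
  also have "\<dots> = ennreal (C\<^sup>2 / l ^ 5) * (\<integral>\<^sup>+x. ennreal ((norm (g x))\<^sup>2) \<partial>lborel)"
  proof -
    have "(\<integral>\<^sup>+x. ennreal ((norm (g x))\<^sup>2) \<partial>lborel) = ennreal (\<integral>x. (norm (g x))\<^sup>2 \<partial>lborel)"
      by (rule nn_integral_eq_integral[OF gint]) simp
    moreover have "0 \<le> C\<^sup>2 / l ^ 5" using l by simp
    moreover have "0 \<le> (\<integral>x. (norm (g x))\<^sup>2 \<partial>lborel)"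
      unfolding L2sq[symmetric] by simp
    ultimately show ?thesis by (simp only: ennreal_mult)
  qed
  finally show ?thesis unfolding gS .
qed

section \<open>The kernel cutoff\<close>

text \<open>Lebesgue measure is determined by its values on boxes, and the preimage of a box is its
  image under the inverse orthogonal map, of the same measure. This is the change of variables
  behind the reflection argument.\<close>

lemma distr_lborel_orthogonal:
  fixes T :: "real^'n::{finite,wellorder} \<Rightarrow> real^'n::_"
  assumes T: "orthogonal_transformation T"
  shows "distr lborel borel T = lborel"
proof (rule sym, rule lborel_eqI)
  have lin: "linear T" using T by (rule orthogonal_transformation_linear)
  have [measurable]: "T \<in> borel_measurable borel"
    by (intro borel_measurable_continuous_onI linear_continuous_on linear_conv_bounded_linear[THEN iffD1] lin)
  fix l u :: "real^'n::_" assume le: "\<And>b. b \<in> Basis \<Longrightarrow> l \<bullet> b \<le> u \<bullet> b"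
  have inv: "orthogonal_transformation (inv T)" using T by (rule orthogonal_transformation_inv)
  have vim: "T -` box l u = inv T ` box l u"
    using bij_vimage_eq_inv_image[OF orthogonal_transformation_bij[OF T]] .
  have m: "inv T ` box l u \<in> lmeasurable"
    by (rule measurable_orthogonal_image[OF inv]) simp
  have "emeasure (distr lborel borel T) (box l u) = emeasure lborel (T -` box l u)"
    by (subst emeasure_distr) auto
  also have "\<dots> = emeasure lebesgue (T -` box l u)"
    using measurable_sets[of T borel borel "box l u"] by simp
  also have "\<dots> = ennreal (measure lebesgue (inv T ` box l u))"
    unfolding vim by (rule emeasure_eq_measure2[OF m])
  also have "\<dots> = ennreal (measure lebesgue (box l u))"
    by (subst measure_orthogonal_image[OF inv]) simp_all
  also have "\<dots> = ennreal (\<Prod>b\<in>Basis. (u - l) \<bullet> b)"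
    using le by (simp add: measure_completion measure_lborel_box inner_diff_left)
  finally show "emeasure (distr lborel borel T) (box l u) = (\<Prod>b\<in>Basis. (u - l) \<bullet> b)" .
qed simp

lemma nn_integral_lborel_scale:
  fixes f :: "'a::euclidean_space \<Rightarrow> ennreal"
  assumes [measurable]: "f \<in> borel_measurable borel" and c: "c > 0"
  shows "(\<integral>\<^sup>+x. f x \<partial>lborel) = ennreal (c ^ DIM('a)) * (\<integral>\<^sup>+x. f (c *\<^sub>R x) \<partial>lborel)"
proof -
  have "(\<integral>\<^sup>+x. f x \<partial>lborel)
    = (\<integral>\<^sup>+x. f x \<partial>density (distr lborel borel (\<lambda>x. 0 + c *\<^sub>R x)) (\<lambda>_. ennreal (\<bar>c\<bar> ^ DIM('a))))"
    by (rule arg_cong[where f="\<lambda>M. nn_integral M f"], rule lborel_affine) (use c in simp)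
  also have "\<dots> = (\<integral>\<^sup>+x. ennreal (\<bar>c\<bar> ^ DIM('a)) * f x \<partial>distr lborel borel (\<lambda>x. 0 + c *\<^sub>R x))"
    by (rule nn_integral_density) simp_all
  also have "\<dots> = (\<integral>\<^sup>+x. ennreal (\<bar>c\<bar> ^ DIM('a)) * f (0 + c *\<^sub>R x) \<partial>lborel)"
    by (rule nn_integral_distr) simp_all
  also have "\<dots> = ennreal (\<bar>c\<bar> ^ DIM('a)) * (\<integral>\<^sup>+x. f (0 + c *\<^sub>R x) \<partial>lborel)"
    by (rule nn_integral_cmult) simp
  finally show ?thesis using c by simp
qed

lemma term_le_suminf: "f k \<le> (\<Sum>k. f k)" for f :: "nat \<Rightarrow> ennreal"
  using sum_le_suminf[of f "{k}"] by simp

text \<open>Dyadic shells replace polar coordinates: on the shell of outer radius 2^-k the integrand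
  is at most 4^(k+1), and the ball of that radius has volume of order 8^-k, leaving a geometric
  series of ratio 1/2.\<close>

lemma nn_integral_inverse_square_ball:
  "(\<integral>\<^sup>+z\<in>ball (0::real^3) 1. ennreal (1 / (norm z)\<^sup>2) \<partial>lborel) < \<infinity>"
proof -
  define V where "V = unit_ball_vol (DIM(real^3))"
  have V: "V \<ge> 0" by (simp add: V_def)
  have "(\<integral>\<^sup>+z\<in>ball (0::real^3) 1. ennreal (1 / (norm z)\<^sup>2) \<partial>lborel)
    \<le> (\<integral>\<^sup>+z. (\<Sum>k. ennreal (4 * 4 ^ k) * indicator (cball (0::real^3) ((1/2) ^ k)) z) \<partial>lborel)"
  proof (rule nn_integral_mono)
    fix z :: "real^3"
    show "ennreal (1 / (norm z)\<^sup>2) * indicator (ball 0 1) z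
      \<le> (\<Sum>k. ennreal (4 * 4 ^ k) * indicator (cball (0::real^3) ((1/2) ^ k)) z)"
    proof (cases "z \<noteq> 0 \<and> norm z < 1")
      case False
      \<comment> \<open>At the origin the integrand is 0 by the convention for division by
        zero.\<close>
      then have "ennreal (1 / (norm z)\<^sup>2) * indicator (ball 0 1) z = 0" by (auto simp: indicator_def)
      then show ?thesis by (simp only: zero_le)
    next
      case True
      \<comment> \<open>The index of the shell containing z: minimality supplies the upper radius,
        and for k = 0 the bound \<open>norm z < 1\<close> does.\<close>
      define k where "k = (LEAST k. (1/2::real) ^ Suc k < norm z)"
      obtain n where "(1/2::real) ^ n < norm z"
        using True real_arch_pow_inv[of "norm z" "1/2"] by auto
      then have "(1/2::real) ^ Suc n < norm z"
        by (rule le_less_trans[rotated]) simp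
      then have k: "(1/2::real) ^ Suc k < norm z"
        unfolding k_def by (rule LeastI)
      have up: "norm z \<le> (1/2) ^ k"
      proof (cases k)
        case 0 then show ?thesis using True by simp
      next
        case (Suc j)
        then have "\<not> (1/2::real) ^ Suc j < norm z"
          unfolding k_def using not_less_Least[of j "\<lambda>k. (1/2::real) ^ Suc k < norm z"] by simp
        then show ?thesis unfolding Suc by simp
      qed
      have "((1/2::real) ^ Suc k)\<^sup>2 \<le> (norm z)\<^sup>2"
        using k by (intro power_mono) auto
      then have "1 / (norm z)\<^sup>2 \<le> 1 / ((1/2::real) ^ Suc k)\<^sup>2"
        by (intro divide_left_mono) (use True in auto)
      also have "\<dots> = 4 * 4 ^ k"
      proof -
        have "((1/2::real) ^ Suc k)\<^sup>2 = ((1/2)\<^sup>2) ^ Suc k" by (metis power_mult mult.commute)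
        then show ?thesis by (simp add: power_one_over)
      qed
      finally have "ennreal (1 / (norm z)\<^sup>2) \<le> ennreal (4 * 4 ^ k)" by (rule ennreal_leI)
      then have "ennreal (1 / (norm z)\<^sup>2) * indicator (ball 0 1) z
          \<le> ennreal (4 * 4 ^ k) * indicator (cball (0::real^3) ((1/2) ^ k)) z"
        using True up by (simp add: indicator_def)
      also have "\<dots> \<le> (\<Sum>k. ennreal (4 * 4 ^ k) * indicator (cball (0::real^3) ((1/2) ^ k)) z)"
        by (rule term_le_suminf)
      finally show ?thesis .
    qed
  qed
  also have "\<dots> = (\<Sum>k. ennreal (4 * 4 ^ k) * emeasure lborel (cball (0::real^3) ((1/2) ^ k)))"
  proof -
    have [measurable]: "cball (0::real^3) R \<in> sets borel" for R by simp
    show ?thesis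
      by (subst nn_integral_suminf, measurable) (simp add: nn_integral_cmult_indicator)
  qed
  also have "\<dots> = (\<Sum>k. ennreal (4 * V * (1/2) ^ k))"
  proof (rule arg_cong[where f=suminf], rule ext)
    fix k :: nat
    have "ennreal (4 * 4 ^ k) * emeasure lborel (cball (0::real^3) ((1/2) ^ k))
      = ennreal (4 * 4 ^ k * (V * ((1/2) ^ k) ^ 3))"
      using V by (simp add: emeasure_cball V_def ennreal_mult'[symmetric])
    also have "4 * 4 ^ k * (V * ((1/2) ^ k) ^ 3) = 4 * V * (1/2) ^ k"
    proof -
      have "(4::real) ^ k * ((1/2) ^ k) ^ 3 = (4 * (1/2)^3) ^ k"
        by (simp only: power_mult_distrib flip: power_mult) (simp add: mult.commute)
      then show ?thesis by (simp add: power3_eq_cube)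
    qed
    finally show "ennreal (4 * 4 ^ k) * emeasure lborel (cball (0::real^3) ((1/2) ^ k)) = ennreal (4 * V * (1/2) ^ k)" .
  qed
  also have "\<dots> < \<infinity>"
  proof -
    have s: "summable (\<lambda>k. 4 * V * (1/2::real) ^ k)" by (intro summable_mult summable_geometric) simp
    have "(\<Sum>k. ennreal (4 * V * (1/2) ^ k)) = ennreal (\<Sum>k. 4 * V * (1/2) ^ k)"
      by (rule suminf_ennreal2[OF _ s]) (use V in simp)
    then show ?thesis by simp
  qed
  finally show ?thesis .
qed

locale cutoff =
  fixes \<theta> :: "real^3 \<Rightarrow> real"
  assumes \<theta>_Cc: "\<theta> \<in> Cc_infty (ball 0 1)"
    and \<theta>_radial: "radial \<theta>"
    and \<theta>_nonneg: "0 \<le> \<theta> x" and \<theta>_le_1: "\<theta> x \<le> 1"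
    and \<theta>_eq_1: "x \<in> ball 0 (1 / 2) \<Longrightarrow> \<theta> x = 1"
begin

lemma \<theta>_support: "1 \<le> norm x \<Longrightarrow> \<theta> x = 0"
  by (rule Cc_infty_ball_support[OF \<theta>_Cc])

lemma \<theta>_measurable [measurable]: "\<theta> \<in> borel_measurable borel"
  by (intro test_fun_measurable Cc_infty_ball_test_fun[OF \<theta>_Cc])

lemma weight_finite: "(\<integral>\<^sup>+w. ennreal (\<theta> w / (norm w)\<^sup>2) \<partial>lborel) < \<infinity>"
proof (rule le_less_trans[OF nn_integral_mono nn_integral_inverse_square_ball])
  fix w :: "real^3"
  show "ennreal (\<theta> w / (norm w)\<^sup>2) \<le> ennreal (1 / (norm w)\<^sup>2) * indicator (ball 0 1) w"
    using \<theta>_support[of w] \<theta>_le_1[of w]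
    by (cases "1 \<le> norm w") (auto intro!: ennreal_leI divide_right_mono)
qed

text \<open>Finiteness of the weight ensures that \<open>C_cutoff\<close> is the true integral and
  not the default 0 of a non-integrable function.\<close>

lemma weight_eq_C_cutoff: "(\<integral>\<^sup>+w. ennreal (\<theta> w / (norm w)\<^sup>2) \<partial>lborel) = ennreal (C_cutoff \<theta>)"
proof -
  have int: "integrable lborel (\<lambda>w. \<theta> w / (norm w)\<^sup>2)"
    by (rule integrableI_bounded) (use weight_finite \<theta>_nonneg in \<open>auto simp: abs_of_nonneg\<close>)
  have "C_cutoff \<theta> = (\<integral>w. \<theta> w / (norm w)\<^sup>2 \<partial>lebesgue)"
    unfolding C_cutoff_def set_lebesgue_integral_def
  proof (rule Bochner_Integration.integral_cong[OF refl])
    fix w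
    show "indicator (ball 0 1) w *\<^sub>R (\<theta> w / (norm w)\<^sup>2) = \<theta> w / (norm w)\<^sup>2"
      using \<theta>_support[of w] by (cases "1 \<le> norm w") auto
  qed
  also have "\<dots> = (\<integral>w. \<theta> w / (norm w)\<^sup>2 \<partial>lborel)"
    by (rule integral_completion) simp
  finally have "C_cutoff \<theta> = (\<integral>w. \<theta> w / (norm w)\<^sup>2 \<partial>lborel)" .
  then show ?thesis
    using nn_integral_eq_integral[OF int] \<theta>_nonneg by simp
qed

text \<open>Positivity is needed because Young's parameter will be divided by this constant.\<close>

lemma C_cutoff_pos: "C_cutoff \<theta> > 0"
proof -
  \<comment> \<open>This ball lies in the annulus 1/4 < |w| < 1/2, where the cutoff is 1 and the
    weight exceeds 1.\<close>
  define b where "b = ball ((3/8) *\<^sub>R axis 1 1 :: real^3) (1/8)"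
  have "0 < emeasure lborel b"
    unfolding b_def by (simp add: emeasure_ball)
  also have "emeasure lborel b = (\<integral>\<^sup>+w. indicator b w \<partial>lborel)"
    by (simp add: b_def)
  also have "\<dots> \<le> (\<integral>\<^sup>+w. ennreal (\<theta> w / (norm w)\<^sup>2) \<partial>lborel)"
  proof (rule nn_integral_mono)
    fix w :: "real^3"
    show "indicator b w \<le> ennreal (\<theta> w / (norm w)\<^sup>2)"
    proof (cases "w \<in> b")
      case True
      then have "norm ((3/8) *\<^sub>R axis 1 1 - w) < 1/8" by (simp add: b_def dist_norm)
      then have n: "norm w < 1/2" "norm w > 1/4"
        using norm_triangle_ineq2[of "(3/8) *\<^sub>R axis 1 1" w] norm_triangle_ineq3[of "(3/8) *\<^sub>R axis 1 1" w]
        by (auto simp: norm_axis_1)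
      then have "(norm w)\<^sup>2 \<le> 1\<^sup>2" by (intro power_mono) auto
      moreover have "norm w > 0" using n by linarith
      ultimately have "1 \<le> 1 / (norm w)\<^sup>2" by (simp add: field_simps)
      moreover have "\<theta> w = 1" using n by (intro \<theta>_eq_1) simp
      ultimately show ?thesis using True by simp
    qed simp
  qed
  finally show ?thesis by (simp add: weight_eq_C_cutoff)
qed

text \<open>Dilation contributes \<kappa>^3 from the volume and \<kappa>^-2 from the weight.\<close>

lemma weight_scaled:
  assumes \<kappa>: "\<kappa> > 0"
  shows "(\<integral>\<^sup>+z. ennreal (\<theta> (z /\<^sub>R \<kappa>) / (norm z)\<^sup>2) \<partial>lborel) = ennreal (\<kappa> * C_cutoff \<theta>)"
proof -
  have "(\<integral>\<^sup>+z. ennreal (\<theta> (z /\<^sub>R \<kappa>) / (norm z)\<^sup>2) \<partial>lborel)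
     = ennreal (\<kappa> ^ 3) * (\<integral>\<^sup>+z. ennreal (\<theta> ((\<kappa> *\<^sub>R z) /\<^sub>R \<kappa>) / (norm (\<kappa> *\<^sub>R z))\<^sup>2) \<partial>lborel)"
    using nn_integral_lborel_scale[of "\<lambda>z. ennreal (\<theta> (z /\<^sub>R \<kappa>) / (norm z)\<^sup>2)" \<kappa>] \<kappa> by simp
  also have "\<dots> = (\<integral>\<^sup>+z. ennreal (\<kappa> ^ 3) * ennreal (\<theta> ((\<kappa> *\<^sub>R z) /\<^sub>R \<kappa>) / (norm (\<kappa> *\<^sub>R z))\<^sup>2) \<partial>lborel)"
    by (rule nn_integral_cmult[symmetric]) simp
  also have "\<dots> = (\<integral>\<^sup>+z. ennreal \<kappa> * ennreal (\<theta> z / (norm z)\<^sup>2) \<partial>lborel)"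
  proof (rule nn_integral_cong)
    fix z :: "real^3"
    have "\<kappa> ^ 3 * (\<theta> ((\<kappa> *\<^sub>R z) /\<^sub>R \<kappa>) / (norm (\<kappa> *\<^sub>R z))\<^sup>2) = \<kappa> * (\<theta> z / (norm z)\<^sup>2)"
      using \<kappa> by (simp add: power_mult_distrib power2_eq_square power3_eq_cube)
    then show "ennreal (\<kappa> ^ 3) * ennreal (\<theta> ((\<kappa> *\<^sub>R z) /\<^sub>R \<kappa>) / (norm (\<kappa> *\<^sub>R z))\<^sup>2)
        = ennreal \<kappa> * ennreal (\<theta> z / (norm z)\<^sup>2)"
      using \<kappa> by (metis ennreal_mult' less_imp_le zero_less_power)
  qed
  also have "\<dots> = ennreal \<kappa> * (\<integral>\<^sup>+z. ennreal (\<theta> z / (norm z)\<^sup>2) \<partial>lborel)"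
    by (rule nn_integral_cmult) simp
  also have "\<dots> = ennreal (\<kappa> * C_cutoff \<theta>)"
    using \<kappa> by (simp add: weight_eq_C_cutoff ennreal_mult')
  finally show ?thesis .
qed

end

section \<open>The near-field kernel\<close>

lemma outer_mult_vec: "outer a b *v w = (b \<bullet> w) *\<^sub>R a"
  by (simp add: outer_def vec_eq_iff matrix_vector_mult_def inner_vec_def sum_distrib_left
      sum_distrib_right mult_ac)

lemma norm_outer: "norm (outer a b) = norm a * norm b"
proof -
  have "outer a b $ i = (a $ i) *\<^sub>R b" for i by (simp add: outer_def vec_eq_iff)
  then have "norm (outer a b) = L2_set (\<lambda>i. \<bar>a $ i\<bar> * norm b) UNIV"
    by (simp add: norm_vec_def[of "outer a b"])
  also have "\<dots> = norm a * norm b"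
    by (simp add: L2_set_left_distrib[symmetric] norm_vec_def[of a])
  finally show ?thesis .
qed

lemma continuous_on_outer [continuous_intros]:
  "continuous_on S f \<Longrightarrow> continuous_on S g \<Longrightarrow> continuous_on S (\<lambda>x. outer (f x) (g x))"
  unfolding outer_def by (intro continuous_intros)

lemma borel_measurable_outer [measurable (raw)]:
  "f \<in> borel_measurable M \<Longrightarrow> g \<in> borel_measurable M \<Longrightarrow> (\<lambda>x. outer (f x) (g x)) \<in> borel_measurable M"
  by (rule borel_measurable_continuous_Pair[where H=outer]) (assumption | intro continuous_intros)+

lemma borel_measurable_cross3 [measurable (raw)]:
  "f \<in> borel_measurable M \<Longrightarrow> g \<in> borel_measurable M \<Longrightarrow> (\<lambda>x. cross3 (f x) (g x)) \<in> borel_measurable M"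
  by (rule borel_measurable_continuous_Pair[where H=cross3])
     (assumption | intro continuous_intros continuous_on_cross)+

text \<open>Polarisation at \<open>axis i 1 + axis j 1\<close>. It reduces the vanishing of a matrix
  integral to that of scalar integrals, one for each v, each with its own reflection.\<close>

lemma symmetric_matrix_eq_0:
  fixes A :: "real^'n^'n"
  assumes sym: "\<And>i j. A $ i $ j = A $ j $ i" and q: "\<And>v. (A *v v) \<bullet> v = 0"
  shows "A = 0"
proof -
  have "A $ i $ j = 0" for i j
  proof -
    have e: "(A *v axis b 1) \<bullet> axis a 1 = A $ a $ b" for a b
      by (simp add: inner_axis matrix_vector_mult_basis column_def)
    have "(A *v (axis i 1 + axis j 1)) \<bullet> (axis i 1 + axis j 1) = 0" by (rule q)
    then show ?thesis
      using q[of "axis i 1"] q[of "axis j 1"] sym[of i j]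
      by (simp add: matrix_vector_right_distrib inner_add_left inner_add_right e)
  qed
  then show ?thesis by (simp add: vec_eq_iff)
qed

lemma bounded_linear_quadratic_form: "bounded_linear (\<lambda>A::real^'n^'n. (A *v v) \<bullet> v)"
proof -
  have "linear (\<lambda>A::real^'n^'n. (A *v v) \<bullet> v)"
    by (intro linearI)
       (simp_all add: matrix_vector_mult_add_rdistrib inner_add_left scaleR_matrix_vector_assoc[symmetric])
  then show ?thesis by (simp add: linear_conv_bounded_linear)
qed

definition reflection :: "'a::euclidean_space \<Rightarrow> 'a \<Rightarrow> 'a" where
  "reflection v z = z - (2 * (z \<bullet> v) / (v \<bullet> v)) *\<^sub>R v"

lemma linear_reflection: "linear (reflection v)"
  by (intro linearI)
     (simp_all add: reflection_def inner_add_left algebra_simps add_divide_distrib)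

lemma orthogonal_reflection:
  assumes "v \<noteq> 0" shows "orthogonal_transformation (reflection v)"
proof -
  have "reflection v a \<bullet> reflection v b = a \<bullet> b" for a b
  proof -
    have "v \<bullet> v \<noteq> 0" using assms by simp
    then show ?thesis
      by (simp add: reflection_def inner_diff_left inner_diff_right inner_commute field_simps)
  qed
  then show ?thesis
    using linear_reflection by (simp add: orthogonal_transformation_def)
qed

lemma reflection_inner_self: "v \<noteq> 0 \<Longrightarrow> reflection v z \<bullet> v = - (z \<bullet> v)"
  by (simp add: reflection_def inner_diff_left)

lemma reflection_inner_orthogonal: "v \<bullet> b = 0 \<Longrightarrow> reflection v z \<bullet> b = z \<bullet> b"
  by (simp add: reflection_def inner_diff_left)

context cutoff
begin

definition kern :: "real \<Rightarrow> real^3 \<Rightarrow> real^3 \<Rightarrow> real^3^3" where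
  "kern \<kappa> z a = (\<theta> (z /\<^sub>R \<kappa>) / (norm z)^3) *\<^sub>R
     (outer (cross3 (sgn z) a) (sgn z) + outer (sgn z) (cross3 (sgn z) a))"

lemma S_near_kern:
  "S_near \<theta> \<kappa> \<Omega> (x, t) = (3 / (8 * pi)) *\<^sub>R pv_integral (\<lambda>z. kern \<kappa> z (\<Omega> (x - z, t)))"
  by (simp add: S_near_def kern_def)

lemma kern_symmetric: "kern \<kappa> z a $ i $ j = kern \<kappa> z a $ j $ i"
  by (simp add: kern_def outer_def mult.commute)

lemma kern_diff: "kern \<kappa> z (a - b) = kern \<kappa> z a - kern \<kappa> z b"
proof -
  have c: "cross3 y (a - b) = cross3 y a - cross3 y b" for y
    by (simp add: linear_diff[OF bounded_linear.linear[OF bounded_linear_cross3]])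
  have o: "outer (p - q) y = outer p y - outer q y" "outer y (p - q) = outer y p - outer y q" for p q y
    by (simp_all add: outer_def vec_eq_iff left_diff_distrib right_diff_distrib)
  show ?thesis unfolding kern_def c o scaleR_diff_right[symmetric] by (simp add: algebra_simps)
qed

lemma kern_eq_0: "\<kappa> > 0 \<Longrightarrow> \<kappa> \<le> norm z \<Longrightarrow> kern \<kappa> z a = 0"
  by (simp add: kern_def \<theta>_support field_simps)

lemma kern_measurable [measurable (raw)]:
  assumes [measurable]: "f \<in> borel_measurable M" "g \<in> borel_measurable M"
  shows "(\<lambda>x. kern \<kappa> (f x) (g x)) \<in> borel_measurable M"
  unfolding kern_def sgn_div_norm by measurable

lemma norm_kern_le: "norm (kern \<kappa> z a) \<le> 2 * norm a * (\<theta> (z /\<^sub>R \<kappa>) / (norm z)^3)"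
proof -
  have s: "norm (sgn z) \<le> 1" by (simp add: norm_sgn)
  have c: "norm (cross3 (sgn z) a) \<le> norm a"
    using norm_cross3_le[of "sgn z" a] mult_right_mono[OF s norm_ge_zero[of a]] by simp
  have "norm (outer (cross3 (sgn z) a) (sgn z) + outer (sgn z) (cross3 (sgn z) a))
      \<le> norm (cross3 (sgn z) a) * norm (sgn z) + norm (sgn z) * norm (cross3 (sgn z) a)"
    by (rule order_trans[OF norm_triangle_ineq]) (simp add: norm_outer)
  also have "\<dots> \<le> norm a * 1 + 1 * norm a"
    by (intro add_mono mult_mono s c) auto
  finally have "norm (outer (cross3 (sgn z) a) (sgn z) + outer (sgn z) (cross3 (sgn z) a)) \<le> 2 * norm a"
    by simp
  then have "(\<theta> (z /\<^sub>R \<kappa>) / (norm z)^3) * norm (outer (cross3 (sgn z) a) (sgn z) + outer (sgn z) (cross3 (sgn z) a))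
     \<le> (\<theta> (z /\<^sub>R \<kappa>) / (norm z)^3) * (2 * norm a)"
    by (intro mult_left_mono) (simp_all add: \<theta>_nonneg)
  then show ?thesis
    using \<theta>_nonneg[of "z /\<^sub>R \<kappa>"] by (simp add: kern_def abs_mult mult_ac)
qed

text \<open>By cyclicity of the triple product, the direction of z enters only through inner
  products with w and with \<open>cross3 a w\<close>. These two vectors are orthogonal, so a
  reflection can flip one factor and keep the other.\<close>

lemma kern_quadratic:
  "(kern \<kappa> z a *v w) \<bullet> w = 2 * (\<theta> (z /\<^sub>R \<kappa>) / (norm z)^3) * (sgn z \<bullet> cross3 a w) * (sgn z \<bullet> w)"
proof -
  have "cross3 (sgn z) a \<bullet> w = sgn z \<bullet> cross3 a w"
    by (simp add: cross3_simps)
  then show ?thesis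
    by (simp add: kern_def scaleR_matrix_vector_assoc[symmetric] matrix_vector_mult_add_rdistrib
      outer_mult_vec inner_add_left)
qed

lemma kern_quadratic_le:
  "(kern \<kappa> z a *v w) \<bullet> w \<le> 2 * (\<theta> (z /\<^sub>R \<kappa>) / (norm z)^3) * (norm a * (norm w)\<^sup>2)"
proof -
  have s: "norm (sgn z) \<le> 1" by (simp add: norm_sgn)
  have "(sgn z \<bullet> cross3 a w) * (sgn z \<bullet> w) \<le> \<bar>sgn z \<bullet> cross3 a w\<bar> * \<bar>sgn z \<bullet> w\<bar>"
    unfolding abs_mult[symmetric] by (rule abs_ge_self)
  also have "\<dots> \<le> (norm a * norm w) * norm w"
  proof (intro mult_mono)
    show "\<bar>sgn z \<bullet> cross3 a w\<bar> \<le> norm a * norm w"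
      using Cauchy_Schwarz_ineq2[of "sgn z" "cross3 a w"] norm_cross3_le[of a w]
        mult_right_mono[OF s norm_ge_zero[of "cross3 a w"]] by simp
    show "\<bar>sgn z \<bullet> w\<bar> \<le> norm w"
      using Cauchy_Schwarz_ineq2[of "sgn z" w] mult_right_mono[OF s norm_ge_zero[of w]] by simp
  qed simp_all
  finally have "(sgn z \<bullet> cross3 a w) * (sgn z \<bullet> w) \<le> norm a * (norm w)\<^sup>2"
    by (simp add: power2_eq_square)
  then show ?thesis
    unfolding kern_quadratic mult.assoc
    by (intro mult_left_mono) (simp_all add: \<theta>_nonneg)
qed

lemma kern_annulus_integrable:
  assumes \<kappa>: "\<kappa> > 0" and \<delta>: "\<delta> > 0"
  shows "integrable lborel (\<lambda>z. indicator {z. \<delta> < norm z} z *\<^sub>R kern \<kappa> z a)"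
proof -
  have "integrable lborel (\<lambda>z::real^3. indicator (cball 0 \<kappa>) z * (2 * norm a / \<delta> ^ 3) :: real)"
    by (intro integrable_mult_left integrable_real_indicator)
       (use emeasure_lborel_cball_finite[of "0::real^3" \<kappa>] in auto)
  then show ?thesis
  proof (rule Bochner_Integration.integrable_bound)
    have [measurable]: "{z::real^3. \<delta> < norm z} \<in> sets borel"
      by (intro borel_open open_Collect_less continuous_intros)
    show "(\<lambda>z. indicator {z. \<delta> < norm z} z *\<^sub>R kern \<kappa> z a) \<in> borel_measurable lborel"
      by measurable
    show "AE z in lborel. norm (indicator {z. \<delta> < norm z} z *\<^sub>R kern \<kappa> z a)
        \<le> norm (indicator (cball 0 \<kappa>) z * (2 * norm a / \<delta> ^ 3) :: real)"
    proof (rule AE_I2)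
      fix z :: "real^3"
      show "norm (indicator {z. \<delta> < norm z} z *\<^sub>R kern \<kappa> z a)
        \<le> norm (indicator (cball 0 \<kappa>) z * (2 * norm a / \<delta> ^ 3) :: real)"
      proof (cases "\<delta> < norm z \<and> norm z \<le> \<kappa>")
        case True
        have "\<theta> (z /\<^sub>R \<kappa>) / (norm z)^3 \<le> 1 / \<delta> ^ 3"
          using True \<delta> \<theta>_le_1 by (intro frac_le power_mono) auto
        then have "2 * norm a * (\<theta> (z /\<^sub>R \<kappa>) / (norm z)^3) \<le> 2 * norm a * (1 / \<delta> ^ 3)"
          by (rule mult_left_mono) simp
        then have "norm (kern \<kappa> z a) \<le> 2 * norm a / \<delta> ^ 3"
          using norm_kern_le[of \<kappa> z a] by simp
        then show ?thesis using True \<delta> by simp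
      next
        case False
        then have "norm (indicator {z. \<delta> < norm z} z *\<^sub>R kern \<kappa> z a) = 0"
          using kern_eq_0[OF \<kappa>, of z a] by auto
        then show ?thesis by (simp only: norm_ge_zero)
      qed
    qed
  qed
qed

text \<open>Reflection in \<open>v\<close> changes the sign of the quadratic form at \<open>v\<close>, as \<open>a \<times> v\<close> is orthogonal to \<open>v\<close>.\<close>

lemma kern_annulus_integral:
  assumes \<kappa>: "\<kappa> > 0" and \<delta>: "\<delta> > 0"
  shows "(\<integral>z. indicator {z. \<delta> < norm z} z *\<^sub>R kern \<kappa> z a \<partial>lborel) = 0" (is "?A = 0")
proof (rule symmetric_matrix_eq_0)
  note int = kern_annulus_integrable[OF \<kappa> \<delta>, of a]
  have [measurable]: "{z::real^3. \<delta> < norm z} \<in> sets borel"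
    by (intro borel_open open_Collect_less continuous_intros)
  show "?A $ i $ j = ?A $ j $ i" for i j
  proof -
    have bl: "bounded_linear (\<lambda>A::real^3^3. A $ i $ j)" for i j
      using bounded_linear_compose[OF bounded_linear_vec_nth bounded_linear_vec_nth] .
    show ?thesis
      unfolding integral_bounded_linear[OF bl int, symmetric]
      by (simp add: kern_symmetric[of \<kappa> _ a i j])
  qed
  show "(?A *v v) \<bullet> v = 0" for v
  proof (cases "v = 0")
    case True then show ?thesis by simp
  next
    case False
    define h where "h z = ((indicator {z. \<delta> < norm z} z *\<^sub>R kern \<kappa> z a) *v v) \<bullet> v" for z
    have [measurable]: "h \<in> borel_measurable borel"
    proof -
      have "(\<lambda>z. indicator {z. \<delta> < norm z} z *\<^sub>R kern \<kappa> z a) \<in> borel_measurable borel" by measurable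
      moreover have "(\<lambda>A::real^3^3. (A *v v) \<bullet> v) \<in> borel_measurable borel"
        by (intro borel_measurable_continuous_onI linear_continuous_on bounded_linear_quadratic_form)
      ultimately show ?thesis unfolding h_def by (rule measurable_compose)
    qed
    have eq: "(?A *v v) \<bullet> v = (\<integral>z. h z \<partial>lborel)"
      unfolding h_def by (rule integral_bounded_linear[OF bounded_linear_quadratic_form int, symmetric])
    let ?R = "reflection v"
    note R = orthogonal_reflection[OF False]
    have [measurable]: "?R \<in> borel_measurable borel"
      unfolding reflection_def[abs_def] by measurable
    have hR: "h (?R z) = - h z" for z
    proof -
      have n: "norm (?R z) = norm z" by (rule orthogonal_transformation_norm[OF R])
      have th: "\<theta> (?R z /\<^sub>R \<kappa>) = \<theta> (z /\<^sub>R \<kappa>)"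
        using \<theta>_radial n unfolding radial_def by (metis norm_scaleR)
      have s: "sgn (?R z) \<bullet> y = (?R z \<bullet> y) / norm z" "sgn z \<bullet> y = (z \<bullet> y) / norm z" for y
        by (simp_all add: sgn_div_norm n divide_inverse_commute)
      have i: "?R z \<bullet> v = - (z \<bullet> v)" "?R z \<bullet> cross3 a v = z \<bullet> cross3 a v"
        by (simp_all add: reflection_inner_self[OF False] reflection_inner_orthogonal dot_cross_self)
      have "(kern \<kappa> (?R z) a *v v) \<bullet> v = - ((kern \<kappa> z a *v v) \<bullet> v)"
        unfolding kern_quadratic s th n i by simp
      then show ?thesis
        unfolding h_def by (simp add: n indicator_def)
    qed
    have "(\<integral>z. h z \<partial>lborel) = (\<integral>z. h z \<partial>distr lborel borel ?R)"
      by (simp add: distr_lborel_orthogonal[OF R])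
    also have "\<dots> = (\<integral>z. h (?R z) \<partial>lborel)"
      by (rule integral_distr) simp_all
    also have "\<dots> = - (\<integral>z. h z \<partial>lborel)"
      by (simp add: hR)
    finally show ?thesis unfolding eq by simp
  qed
qed

end

section \<open>Young's inequality and increments of the vorticity\<close>

lemma young_weighted:
  fixes a b \<eta> :: real
  assumes "\<eta> > 0"
  shows "a * b \<le> \<eta> * a\<^sup>2 + b\<^sup>2 / (4 * \<eta>)"
proof -
  have "0 \<le> (2 * \<eta> * a - b)\<^sup>2" by simp
  then have "4 * \<eta> * (a * b) \<le> 4 * \<eta> * (\<eta> * a\<^sup>2 + b\<^sup>2 / (4 * \<eta>))"
    using assms by (simp add: power2_eq_square algebra_simps)
  then show ?thesis using assms by (simp only: mult_le_cancel_left_pos)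
qed

text \<open>Fundamental theorem of calculus along the segment from x to x - z. Keeping the average
  over the segment, instead of a supremum, is what later allows Tonelli's theorem to produce an
  integral of the squared gradient.\<close>

lemma vort_increment:
  assumes k: "test_fun k" "loc_int f"
  shows "ennreal (norm (vort k f (x - z) - vort k f x))
    \<le> ennreal (norm z) * (\<integral>\<^sup>+s\<in>{0..1}. ennreal (norm (grad (vort k f) (x - s *\<^sub>R z))) \<partial>lborel)"
proof -
  define F where "F s = vort k f (x - s *\<^sub>R z)" for s :: real
  define f' where "f' s = dvort k f (x - s *\<^sub>R z) (- z)" for s :: real
  have der: "(F has_vector_derivative f' s) (at s within {0..1})" for s
  proof -
    have "(F has_derivative (\<lambda>h. dvort k f (x - s *\<^sub>R z) (h *\<^sub>R (- z)))) (at s within {0..1})"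
      unfolding F_def
      by (rule has_derivative_compose[OF _ vort_has_derivative[OF k], where f="\<lambda>s. x - s *\<^sub>R z"])
         (auto intro!: derivative_eq_intros)
    then show ?thesis
      unfolding has_vector_derivative_def f'_def
      by (simp only: linear_scale[OF dvort_linear[OF k]])
  qed
  have cont: "continuous_on {0..1} f'"
    unfolding f'_def
    by (rule continuous_on_compose2[OF dvort_continuous[OF k, of UNIV]]) (auto intro!: continuous_intros)
  note FTC = integral_FTC_Icc[of 0 1 F f', OF _ der cont] has_bochner_integral_FTC_Icc[of 0 1 F f', OF _ der cont]
  have int: "integrable lborel (\<lambda>s. indicator {0..1} s *\<^sub>R f' s)"
    using FTC(2) has_bochner_integral_iff by fastforce
  have meas [measurable]: "(\<lambda>s. norm (grad (vort k f) (x - s *\<^sub>R z))) \<in> borel_measurable borel"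
    by (intro borel_measurable_continuous_onI
        continuous_on_compose2[OF continuous_norm_grad_vort[OF k, of UNIV]]) (auto intro!: continuous_intros)
  have "ennreal (norm (vort k f (x - z) - vort k f x)) = ennreal (norm (\<integral>s. indicator {0..1} s *\<^sub>R f' s \<partial>lborel))"
    using FTC(1) by (simp add: F_def)
  also have "\<dots> \<le> (\<integral>\<^sup>+s. ennreal (norm (indicator {0..1} s *\<^sub>R f' s)) \<partial>lborel)"
    by (rule integral_norm_bound_ennreal[OF int])
  also have "\<dots> \<le> (\<integral>\<^sup>+s. ennreal (norm z) * (ennreal (norm (grad (vort k f) (x - s *\<^sub>R z))) * indicator {0..1} s) \<partial>lborel)"
  proof (rule nn_integral_mono)
    fix s :: real
    have "norm (f' s) \<le> norm z * norm (grad (vort k f) (x - s *\<^sub>R z))"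
      unfolding f'_def using norm_dvort_le[OF k, of "x - s *\<^sub>R z" "- z"] by (simp add: mult.commute)
    then have "ennreal (norm (f' s)) \<le> ennreal (norm z) * ennreal (norm (grad (vort k f) (x - s *\<^sub>R z)))"
      by (simp only: ennreal_mult[OF norm_ge_zero norm_ge_zero, symmetric] ennreal_leI)
    then show "ennreal (norm (indicator {0..1} s *\<^sub>R f' s))
        \<le> ennreal (norm z) * (ennreal (norm (grad (vort k f) (x - s *\<^sub>R z))) * indicator {0..1} s)"
      by (cases "s \<in> {0..1}") simp_all
  qed
  also have "\<dots> = ennreal (norm z) * (\<integral>\<^sup>+s\<in>{0..1}. ennreal (norm (grad (vort k f) (x - s *\<^sub>R z))) \<partial>lborel)"
    by (rule nn_integral_cmult) measurable
  finally show ?thesis .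
qed

text \<open>A qualitative bound: L depends on the point and the slice and never enters the final
  estimate. It serves to make the principal value absolutely convergent.\<close>

lemma vort_lipschitz:
  assumes k: "test_fun k" "loc_int f"
  obtains L where "\<And>z. norm z \<le> \<kappa> \<Longrightarrow> norm (vort k f (x - z) - vort k f x) \<le> L * norm z"
proof -
  have "compact ((\<lambda>y. norm (grad (vort k f) y)) ` cball x \<kappa>)"
    by (intro compact_continuous_image continuous_norm_grad_vort k compact_cball)
  then have "bounded ((\<lambda>y. norm (grad (vort k f) y)) ` cball x \<kappa>)" by (rule compact_imp_bounded)
  then obtain L where "\<forall>v\<in>(\<lambda>y. norm (grad (vort k f) y)) ` cball x \<kappa>. norm v \<le> L"
    unfolding bounded_iff by blast
  then have L: "norm (grad (vort k f) y) \<le> L" if "y \<in> cball x \<kappa>" for y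
    using that by simp
  show thesis
  proof
    fix z :: "real^3" assume z: "norm z \<le> \<kappa>"
    have "norm (vort k f (x - z) - vort k f x) \<le> L * norm (x - z - x)"
    proof (rule differentiable_bound[where S="cball x \<kappa>"])
      show "convex (cball x \<kappa>)" by simp
      show "(vort k f has_derivative dvort k f y) (at y within cball x \<kappa>)" for y
        by (rule has_derivative_at_withinI[OF vort_has_derivative[OF k]])
      have "0 \<le> \<kappa>" using z norm_ge_zero order_trans by blast
      then show "x - z \<in> cball x \<kappa>" "x \<in> cball x \<kappa>" using z by (simp_all add: dist_norm)
      then have L0: "0 \<le> L" using L norm_ge_zero order_trans by blast
      show "onorm (dvort k f y) \<le> L" if y: "y \<in> cball x \<kappa>" for y
      proof (rule onorm_bound[OF L0])
        fix h
        show "norm (dvort k f y h) \<le> L * norm h"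
          using norm_dvort_le[OF k, of y h] mult_right_mono[OF L[OF y] norm_ge_zero[of h]] by linarith
      qed
    qed
    then show "norm (vort k f (x - z) - vort k f x) \<le> L * norm z" by simp
  qed
qed

section \<open>The principal value as an absolutely convergent integral\<close>

context cutoff
begin

lemma weight_integrable:
  assumes "\<kappa> > 0"
  shows "integrable lborel (\<lambda>z. \<theta> (z /\<^sub>R \<kappa>) / (norm z)\<^sup>2)"
proof (rule integrableI_bounded)
  have "(\<integral>\<^sup>+z. ennreal (norm (\<theta> (z /\<^sub>R \<kappa>) / (norm z)\<^sup>2)) \<partial>lborel) = ennreal (\<kappa> * C_cutoff \<theta>)"
    unfolding weight_scaled[OF assms, symmetric]
    by (rule nn_integral_cong) (simp add: \<theta>_nonneg abs_of_nonneg)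
  then show "(\<integral>\<^sup>+z. ennreal (norm (\<theta> (z /\<^sub>R \<kappa>) / (norm z)\<^sup>2)) \<partial>lborel) < \<infinity>" by simp
qed simp

text \<open>The Lipschitz bound lowers the singularity from |z|^-3 to the integrable |z|^-2.
  Subtracting \<open>g x\<close> changes no truncated integral, as the kernel has mean zero outside
  each small ball, and dominated convergence removes the truncation.\<close>

lemma kern_increment:
  assumes \<kappa>: "\<kappa> > 0" and g [measurable]: "g \<in> borel_measurable borel"
    and L: "\<And>z. norm z \<le> \<kappa> \<Longrightarrow> norm (g (x - z) - g x) \<le> L * norm z"
  shows kern_increment_integrable: "integrable lborel (\<lambda>z. kern \<kappa> z (g (x - z) - g x))"
    and pv_integral_kern: "pv_integral (\<lambda>z. kern \<kappa> z (g (x - z)))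
      = (\<integral>z. kern \<kappa> z (g (x - z) - g x) \<partial>lborel)"
proof -
  define H where "H z = kern \<kappa> z (g (x - z) - g x)" for z
  have [measurable]: "H \<in> borel_measurable borel" unfolding H_def[abs_def] by measurable
  have bound: "norm (H z) \<le> 2 * L * (\<theta> (z /\<^sub>R \<kappa>) / (norm z)\<^sup>2)" for z
  proof (cases "norm z \<le> \<kappa>")
    case True
    have "norm (H z) \<le> 2 * (L * norm z) * (\<theta> (z /\<^sub>R \<kappa>) / (norm z)^3)"
      unfolding H_def using L[OF True] \<theta>_nonneg
      by (intro order_trans[OF norm_kern_le] mult_right_mono) simp_all
    also have "\<dots> = 2 * L * (\<theta> (z /\<^sub>R \<kappa>) / (norm z)\<^sup>2)"
      by (simp add: power2_eq_square power3_eq_cube)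
    finally show ?thesis .
  next
    case False
    then have "\<theta> (z /\<^sub>R \<kappa>) = 0" using \<kappa> by (intro \<theta>_support) (simp add: field_simps)
    then show ?thesis by (simp add: H_def kern_def)
  qed
  have wint: "integrable lborel (\<lambda>z. 2 * L * (\<theta> (z /\<^sub>R \<kappa>) / (norm z)\<^sup>2))"
    by (rule integrable_mult_right[OF weight_integrable[OF \<kappa>]])
  have Hint: "integrable lborel H"
    by (rule Bochner_Integration.integrable_bound[OF wint])
       (simp, rule AE_I2, rule order_trans[OF bound], unfold real_norm_def, rule abs_ge_self)
  then show "integrable lborel (\<lambda>z. kern \<kappa> z (g (x - z) - g x))" unfolding H_def[abs_def] .
  define J where "J \<delta> = (\<integral>z. indicator {z. \<delta> < norm z} z *\<^sub>R H z \<partial>lborel)" for \<delta> :: real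
  have set_meas [measurable]: "{z::real^3. \<delta> < norm z} \<in> sets borel" for \<delta>
    by (intro borel_open open_Collect_less continuous_intros)
  have trunc: "(\<integral>z\<in>{z. \<delta> < norm z}. kern \<kappa> z (g (x - z)) \<partial>lebesgue) = J \<delta>" if \<delta>: "\<delta> > 0" for \<delta>
  proof -
    note kint = kern_annulus_integrable[OF \<kappa> \<delta>, of "g x"]
    have Hint': "integrable lborel (\<lambda>z. indicator {z. \<delta> < norm z} z *\<^sub>R H z)"
      by (rule integrable_mult_indicator[OF _ Hint]) simp
    have "(\<integral>z\<in>{z. \<delta> < norm z}. kern \<kappa> z (g (x - z)) \<partial>lebesgue)
       = (\<integral>z. indicator {z. \<delta> < norm z} z *\<^sub>R kern \<kappa> z (g (x - z)) \<partial>lborel)"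
      unfolding set_lebesgue_integral_def by (rule integral_completion) measurable
    also have "\<dots> = (\<integral>z. indicator {z. \<delta> < norm z} z *\<^sub>R H z + indicator {z. \<delta> < norm z} z *\<^sub>R kern \<kappa> z (g x) \<partial>lborel)"
      by (simp add: H_def kern_diff scaleR_diff_right)
    also have "\<dots> = J \<delta>"
      by (simp add: Bochner_Integration.integral_add[OF Hint' kint] kern_annulus_integral[OF \<kappa> \<delta>] J_def)
    finally show ?thesis .
  qed
  \<comment> \<open>Dominated convergence concerns sequences, so the one-sided limit is tested along
    arbitrary positive null sequences.\<close>
  have lim: "(J \<longlongrightarrow> (\<integral>z. H z \<partial>lborel)) (at_right 0)"
    unfolding tendsto_at_iff_sequentially
  proof (intro allI impI)
    fix X :: "nat \<Rightarrow> real"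
    assume X: "\<forall>i. X i \<in> {0<..} - {0}" "X \<longlonglongrightarrow> 0"
    have "(\<lambda>i. \<integral>z. indicator {z. X i < norm z} z *\<^sub>R H z \<partial>lborel) \<longlonglongrightarrow> (\<integral>z. H z \<partial>lborel)"
    proof (rule integral_dominated_convergence)
      show "integrable lborel (\<lambda>z. norm (H z))" using Hint by simp
      show "AE z in lborel. norm (indicator {z. X i < norm z} z *\<^sub>R H z) \<le> norm (H z)" for i
        by (rule AE_I2) (simp add: indicator_def)
      show "AE z in lborel. (\<lambda>i. indicator {z. X i < norm z} z *\<^sub>R H z) \<longlonglongrightarrow> H z"
      proof (rule AE_I2)
        fix z
        show "(\<lambda>i. indicator {z. X i < norm z} z *\<^sub>R H z) \<longlonglongrightarrow> H z"
        proof (cases "z = 0")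
          case True
          \<comment> \<open>The origin is excised by every truncation, but the kernel is 0 there by
            convention, so convergence holds at each z.\<close>
          then have "H z = 0" by (simp add: H_def kern_def)
          then show ?thesis by simp
        next
          case False
          then have "eventually (\<lambda>i. X i < norm z) sequentially"
            using X(2) by (intro order_tendstoD(2)) auto
          then have "eventually (\<lambda>i. indicator {z. X i < norm z} z *\<^sub>R H z = H z) sequentially"
            by eventually_elim simp
          then show ?thesis by (rule tendsto_eventually)
        qed
      qed
    qed simp_all
    then show "(J \<circ> X) \<longlonglongrightarrow> (\<integral>z. H z \<partial>lborel)"
      by (simp add: J_def[abs_def] comp_def)
  qed
  have "((\<lambda>\<delta>. \<integral>z\<in>{z. \<delta> < norm z}. kern \<kappa> z (g (x - z)) \<partial>lebesgue) \<longlongrightarrow> (\<integral>z. H z \<partial>lborel)) (at_right 0)"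
    by (rule Lim_transform_eventually[OF lim])
       (use trunc in \<open>auto simp: eventually_at_right_less intro!: eventually_at_rightI[of 0 1]\<close>)
  \<comment> \<open>\<open>Lim\<close> has a meaningful value only because convergence has been
    established and the limit is unique.\<close>
  then show "pv_integral (\<lambda>z. kern \<kappa> z (g (x - z))) = (\<integral>z. kern \<kappa> z (g (x - z) - g x) \<partial>lborel)"
    unfolding pv_integral_def H_def[symmetric] by (intro tendsto_Lim) simp_all
qed

lemma pv_quadratic_le:
  assumes \<kappa>: "\<kappa> > 0" and g [measurable]: "g \<in> borel_measurable borel"
    and L: "\<And>z. norm z \<le> \<kappa> \<Longrightarrow> norm (g (x - z) - g x) \<le> L * norm z"
  shows "ennreal (max 0 ((pv_integral (\<lambda>z. kern \<kappa> z (g (x - z))) *v g x) \<bullet> g x))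
    \<le> (\<integral>\<^sup>+z. ennreal (2 * (\<theta> (z /\<^sub>R \<kappa>) / (norm z)^3) * (norm (g (x - z) - g x) * (norm (g x))\<^sup>2)) \<partial>lborel)"
proof -
  note int = kern_increment_integrable[OF assms]
  have "ennreal (max 0 ((pv_integral (\<lambda>z. kern \<kappa> z (g (x - z))) *v g x) \<bullet> g x))
    = ennreal (\<integral>z. (kern \<kappa> z (g (x - z) - g x) *v g x) \<bullet> g x \<partial>lborel)"
  proof -
    have "(pv_integral (\<lambda>z. kern \<kappa> z (g (x - z))) *v g x) \<bullet> g x
        = ((\<integral>z. kern \<kappa> z (g (x - z) - g x) \<partial>lborel) *v g x) \<bullet> g x"
      by (subst pv_integral_kern[OF \<kappa> g L]) auto
    also have "\<dots> = (\<integral>z. (kern \<kappa> z (g (x - z) - g x) *v g x) \<bullet> g x \<partial>lborel)"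
      by (rule integral_bounded_linear[OF bounded_linear_quadratic_form int, symmetric])
    \<comment> \<open>\<open>ennreal\<close> sends negative reals to 0 and so absorbs the positive
      part.\<close>
    finally show ?thesis by (simp add: max_def ennreal_neg)
  qed
  also have "\<dots> \<le> (\<integral>\<^sup>+z. ennreal ((kern \<kappa> z (g (x - z) - g x) *v g x) \<bullet> g x) \<partial>lborel)"
  proof -
    have i: "integrable lborel (\<lambda>z. (kern \<kappa> z (g (x - z) - g x) *v g x) \<bullet> g x)"
      by (rule integrable_bounded_linear[OF bounded_linear_quadratic_form int])
    have i': "integrable lborel (\<lambda>z. max 0 ((kern \<kappa> z (g (x - z) - g x) *v g x) \<bullet> g x))"
      using i by (intro integrable_max) auto
    have "(\<integral>z. (kern \<kappa> z (g (x - z) - g x) *v g x) \<bullet> g x \<partial>lborel)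
       \<le> (\<integral>z. max 0 ((kern \<kappa> z (g (x - z) - g x) *v g x) \<bullet> g x) \<partial>lborel)"
      by (rule integral_mono[OF i i']) simp
    then have "ennreal (\<integral>z. (kern \<kappa> z (g (x - z) - g x) *v g x) \<bullet> g x \<partial>lborel)
      \<le> ennreal (\<integral>z. max 0 ((kern \<kappa> z (g (x - z) - g x) *v g x) \<bullet> g x) \<partial>lborel)"
      by (rule ennreal_leI)
    also have "\<dots> = (\<integral>\<^sup>+z. ennreal (max 0 ((kern \<kappa> z (g (x - z) - g x) *v g x) \<bullet> g x)) \<partial>lborel)"
      by (rule nn_integral_eq_integral[OF i', symmetric]) simp
    also have "\<dots> = (\<integral>\<^sup>+z. ennreal ((kern \<kappa> z (g (x - z) - g x) *v g x) \<bullet> g x) \<partial>lborel)"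
      by (rule nn_integral_cong) (simp add: max_def ennreal_neg)
    finally show ?thesis .
  qed
  also have "\<dots> \<le> (\<integral>\<^sup>+z. ennreal (2 * (\<theta> (z /\<^sub>R \<kappa>) / (norm z)^3) * (norm (g (x - z) - g x) * (norm (g x))\<^sup>2)) \<partial>lborel)"
    by (intro nn_integral_mono ennreal_leI kern_quadratic_le)
  finally show ?thesis .
qed

end

section \<open>The pointwise near-field estimate\<close>

lemma norm_grad_vort_measurable:
  "test_fun k \<Longrightarrow> loc_int f \<Longrightarrow> (\<lambda>x. norm (grad (vort k f) x)) \<in> borel_measurable borel"
  by (intro borel_measurable_continuous_onI continuous_norm_grad_vort)

context cutoff
begin

text \<open>Young's inequality is applied under the segment integral to the gradient norm and
  \<open>c * (norm w)\<^sup>2\<close>. As c, the value of the cutoff \<chi> at the point, goes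
  entirely with |w|^2, the gradient term is free of it.\<close>

lemma near_young:
  fixes x :: "real^3"
  assumes \<kappa>: "\<kappa> > 0" and k: "test_fun k" "loc_int f" and c: "0 \<le> c" "c \<le> 1" and \<eta>: "\<eta> > 0"
  defines "w \<equiv> vort k f x"
  shows "ennreal (c * max 0 ((pv_integral (\<lambda>z. kern \<kappa> z (vort k f (x - z))) *v w) \<bullet> w))
    \<le> ennreal (2 * \<eta>) * (\<integral>\<^sup>+z. ennreal (\<theta> (z /\<^sub>R \<kappa>) / (norm z)\<^sup>2) *
          (\<integral>\<^sup>+s\<in>{0..1}. ennreal ((norm (grad (vort k f) (x - s *\<^sub>R z)))\<^sup>2) \<partial>lborel) \<partial>lborel)
      + ennreal (\<kappa> * C_cutoff \<theta> / (2 * \<eta>)) * ennreal (c * norm w ^ 4)"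
proof -
  define G where "G y = norm (grad (vort k f) y)" for y
  have G [measurable]: "G \<in> borel_measurable borel" unfolding G_def[abs_def] by (rule norm_grad_vort_measurable[OF k])
  have G0: "0 \<le> G y" for y by (simp add: G_def)
  have V [measurable]: "vort k f \<in> borel_measurable borel"
    by (intro borel_measurable_continuous_onI vort_continuous k)
  define J where "J z = (\<integral>\<^sup>+s\<in>{0..1}. ennreal (G (x - s *\<^sub>R z)) \<partial>lborel)" for z
  define I where "I z = (\<integral>\<^sup>+s\<in>{0..1}. ennreal ((G (x - s *\<^sub>R z))\<^sup>2) \<partial>lborel)" for z
  \<comment> \<open>The second term of Young's inequality, with c^2 already replaced by c. The
    segment parameter has range of length 1, so integration over it returns e itself.\<close>
  define e where "e = c * norm w ^ 4 / (4 * \<eta>)"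
  have e: "e \<ge> 0" using c \<eta> by (simp add: e_def)
  define wt where "wt z = \<theta> (z /\<^sub>R \<kappa>) / (norm z)\<^sup>2" for z
  have wt0: "0 \<le> wt z" for z by (simp add: wt_def \<theta>_nonneg)
  have wt [measurable]: "wt \<in> borel_measurable borel" unfolding wt_def[abs_def] by measurable
  have [measurable]: "I \<in> borel_measurable borel" unfolding I_def[abs_def] by measurable
  have cJ: "ennreal (c * (norm w)\<^sup>2) * J z \<le> ennreal \<eta> * I z + ennreal e" for z
  proof -
    have "ennreal (c * (norm w)\<^sup>2) * J z
      = (\<integral>\<^sup>+s. ennreal (c * (norm w)\<^sup>2) * (ennreal (G (x - s *\<^sub>R z)) * indicator {0..1} s) \<partial>lborel)"
      unfolding J_def by (rule nn_integral_cmult[symmetric]) measurable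
    also have "\<dots> \<le> (\<integral>\<^sup>+s. ennreal \<eta> * (ennreal ((G (x - s *\<^sub>R z))\<^sup>2) * indicator {0..1} s)
          + ennreal e * indicator {0..1} s \<partial>lborel)"
    proof (rule nn_integral_mono)
      fix s :: real
      let ?g = "G (x - s *\<^sub>R z)"
      have "c * (norm w)\<^sup>2 * ?g = ?g * (c * (norm w)\<^sup>2)" by simp
      also have "\<dots> \<le> \<eta> * ?g\<^sup>2 + (c * (norm w)\<^sup>2)\<^sup>2 / (4 * \<eta>)" by (rule young_weighted[OF \<eta>])
      also have "\<dots> \<le> \<eta> * ?g\<^sup>2 + e"
      proof -
        \<comment> \<open>One factor c has to survive next to |w|^4, since it becomes the \<chi> in
          \<open>O_quant\<close>.\<close>
        have "c\<^sup>2 \<le> c" using c by (simp add: power2_eq_square mult_left_le)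
        then have "c\<^sup>2 * norm w ^ 4 \<le> c * norm w ^ 4" by (rule mult_right_mono) simp
        moreover have "(c * (norm w)\<^sup>2)\<^sup>2 = c\<^sup>2 * norm w ^ 4" by (simp add: power_mult_distrib)
        ultimately show ?thesis using \<eta> by (simp add: e_def divide_right_mono)
      qed
      finally have "ennreal (c * (norm w)\<^sup>2 * ?g) \<le> ennreal (\<eta> * ?g\<^sup>2 + e)" by (rule ennreal_leI)
      then have "ennreal (c * (norm w)\<^sup>2) * ennreal ?g \<le> ennreal \<eta> * ennreal (?g\<^sup>2) + ennreal e"
        using c \<eta> e G0 by (simp add: ennreal_mult[symmetric] ennreal_plus[symmetric] del: ennreal_plus)
      then show "ennreal (c * (norm w)\<^sup>2) * (ennreal ?g * indicator {0..1} s)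
        \<le> ennreal \<eta> * (ennreal (?g\<^sup>2) * indicator {0..1} s) + ennreal e * indicator {0..1} s"
        by (cases "s \<in> {0..1}") simp_all
    qed
    also have "\<dots> = (\<integral>\<^sup>+s. ennreal \<eta> * (ennreal ((G (x - s *\<^sub>R z))\<^sup>2) * indicator {0..1} s) \<partial>lborel)
        + (\<integral>\<^sup>+s. ennreal e * indicator {0..1::real} s \<partial>lborel)"
      by (rule nn_integral_add) measurable
    also have "(\<integral>\<^sup>+s. ennreal \<eta> * (ennreal ((G (x - s *\<^sub>R z))\<^sup>2) * indicator {0..1} s) \<partial>lborel) = ennreal \<eta> * I z"
      unfolding I_def by (rule nn_integral_cmult) measurable
    also have "(\<integral>\<^sup>+s. ennreal e * indicator {0..1::real} s \<partial>lborel) = ennreal e"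
      by (simp add: nn_integral_cmult_indicator)
    finally show ?thesis .
  qed
  obtain L where L: "\<And>z. norm z \<le> \<kappa> \<Longrightarrow> norm (vort k f (x - z) - vort k f x) \<le> L * norm z"
    using vort_lipschitz[OF k] by blast
  have "ennreal (c * max 0 ((pv_integral (\<lambda>z. kern \<kappa> z (vort k f (x - z))) *v w) \<bullet> w))
    = ennreal c * ennreal (max 0 ((pv_integral (\<lambda>z. kern \<kappa> z (vort k f (x - z))) *v w) \<bullet> w))"
    using c by (simp add: ennreal_mult)
  also have "\<dots> \<le> ennreal c * (\<integral>\<^sup>+z. ennreal (2 * (\<theta> (z /\<^sub>R \<kappa>) / (norm z)^3)
        * (norm (vort k f (x - z) - vort k f x) * (norm (vort k f x))\<^sup>2)) \<partial>lborel)"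
    unfolding w_def by (intro mult_left_mono pv_quadratic_le[OF \<kappa> V L]) simp_all
  also have "\<dots> = (\<integral>\<^sup>+z. ennreal c * ennreal (2 * (\<theta> (z /\<^sub>R \<kappa>) / (norm z)^3)
        * (norm (vort k f (x - z) - vort k f x) * (norm (vort k f x))\<^sup>2)) \<partial>lborel)"
    by (rule nn_integral_cmult[symmetric]) measurable
  also have "\<dots> \<le> (\<integral>\<^sup>+z. ennreal (2 * \<eta>) * (ennreal (wt z) * I z) + ennreal (2 * e) * ennreal (wt z) \<partial>lborel)"
  proof (rule nn_integral_mono)
    fix z
    let ?D = "norm (vort k f (x - z) - vort k f x)"
    let ?q = "\<theta> (z /\<^sub>R \<kappa>) / (norm z)^3"
    have q: "0 \<le> ?q" by (simp add: \<theta>_nonneg)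
    \<comment> \<open>The factor |z| gained from the increment turns the |z|^-3 kernel into the
      integrable weight; at z = 0 both sides are 0.\<close>
    have "?q * norm z = wt z" by (simp add: wt_def power2_eq_square power3_eq_cube)
    then have qz: "ennreal ?q * ennreal (norm z) = ennreal (wt z)"
      using ennreal_mult[OF q norm_ge_zero[of z]] by simp
    have "ennreal c * ennreal (2 * p * (d * a)) = 2 * (ennreal p * (ennreal d * ennreal (c * a)))"
      if "0 \<le> p" "0 \<le> d" "0 \<le> a" for p d a
      using c that by (simp add: ennreal_mult mult_ac)
    from this[OF q norm_ge_zero zero_le_power2]
    have "ennreal c * ennreal (2 * ?q * (?D * (norm w)\<^sup>2)) = 2 * (ennreal ?q * (ennreal ?D * ennreal (c * (norm w)\<^sup>2)))" .
    also have "\<dots> \<le> 2 * (ennreal ?q * ((ennreal (norm z) * J z) * ennreal (c * (norm w)\<^sup>2)))"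
      unfolding J_def G_def by (intro mult_left_mono mult_right_mono vort_increment k) simp_all
    also have "\<dots> = 2 * (ennreal (wt z) * (ennreal (c * (norm w)\<^sup>2) * J z))"
      unfolding qz[symmetric] by (simp only: mult_ac)
    also have "\<dots> \<le> 2 * (ennreal (wt z) * (ennreal \<eta> * I z + ennreal e))"
      by (intro mult_left_mono cJ) simp_all
    also have "\<dots> = ennreal (2 * \<eta>) * (ennreal (wt z) * I z) + ennreal (2 * e) * ennreal (wt z)"
    proof -
      have "ennreal (2 * \<eta>) = 2 * ennreal \<eta>" "ennreal (2 * e) = 2 * ennreal e"
        using \<eta> e by (simp_all add: ennreal_mult)
      then show ?thesis by (simp add: distrib_left mult_ac)
    qed
    finally show "ennreal c * ennreal (2 * ?q * (?D * (norm (vort k f x))\<^sup>2))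
      \<le> ennreal (2 * \<eta>) * (ennreal (wt z) * I z) + ennreal (2 * e) * ennreal (wt z)"
      unfolding w_def .
  qed
  also have "\<dots> = (\<integral>\<^sup>+z. ennreal (2 * \<eta>) * (ennreal (wt z) * I z) \<partial>lborel)
      + (\<integral>\<^sup>+z. ennreal (2 * e) * ennreal (wt z) \<partial>lborel)"
    by (rule nn_integral_add) measurable
  also have "(\<integral>\<^sup>+z. ennreal (2 * \<eta>) * (ennreal (wt z) * I z) \<partial>lborel)
      = ennreal (2 * \<eta>) * (\<integral>\<^sup>+z. ennreal (wt z) * I z \<partial>lborel)"
    by (rule nn_integral_cmult) measurable
  also have "(\<integral>\<^sup>+z. ennreal (2 * e) * ennreal (wt z) \<partial>lborel) = ennreal (2 * e) * ennreal (\<kappa> * C_cutoff \<theta>)"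
    unfolding weight_scaled[OF \<kappa>, symmetric] wt_def by (rule nn_integral_cmult) measurable
  also have "\<dots> = ennreal (\<kappa> * C_cutoff \<theta> / (2 * \<eta>)) * ennreal (c * norm w ^ 4)"
  proof -
    have "2 * e * (\<kappa> * C_cutoff \<theta>) = (\<kappa> * C_cutoff \<theta> / (2 * \<eta>)) * (c * norm w ^ 4)"
      using \<eta> by (simp add: e_def field_simps)
    moreover have "0 \<le> \<kappa> * C_cutoff \<theta>" "0 \<le> \<kappa> * C_cutoff \<theta> / (2 * \<eta>)" "0 \<le> c * norm w ^ 4" "0 \<le> 2 * e"
      using C_cutoff_pos \<kappa> \<eta> c e by simp_all
    ultimately show ?thesis by (metis ennreal_mult)
  qed
  finally show ?thesis unfolding I_def wt_def G_def .
qed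

text \<open>With x as innermost variable, the shift by s z has length below \<kappa> wherever the
  weight is nonzero, so it moves the ball of radius r into that of radius r + \<kappa>. The
  resulting bound no longer depends on s or z, and the weight contributes only its mass.\<close>

lemma near_gradient:
  fixes g :: "real^3 \<Rightarrow> ennreal"
  assumes \<kappa>: "\<kappa> > 0" and g [measurable]: "g \<in> borel_measurable borel"
  shows "(\<integral>\<^sup>+x\<in>ball x0 r. (\<integral>\<^sup>+z. ennreal (\<theta> (z /\<^sub>R \<kappa>) / (norm z)\<^sup>2) *
          (\<integral>\<^sup>+s\<in>{0..1}. g (x - s *\<^sub>R z) \<partial>lborel) \<partial>lborel) \<partial>lborel)
    \<le> ennreal (\<kappa> * C_cutoff \<theta>) * (\<integral>\<^sup>+x\<in>ball x0 (r + \<kappa>). g x \<partial>lborel)"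
proof -
  define wt where "wt z = ennreal (\<theta> (z /\<^sub>R \<kappa>) / (norm z)\<^sup>2)" for z
  have [measurable]: "wt \<in> borel_measurable borel" unfolding wt_def[abs_def] by measurable
  have [measurable]: "ball a b \<in> sets borel" for a :: "real^3" and b by simp
  let ?P = "\<integral>\<^sup>+x\<in>ball x0 (r + \<kappa>). g x \<partial>lborel"
  have shift: "(\<integral>\<^sup>+x. g (x - a) * indicator (ball x0 r) x \<partial>lborel) \<le> ?P" if a: "norm a < \<kappa>" for a
  proof -
    have "(\<integral>\<^sup>+x. g (x - a) * indicator (ball x0 r) x \<partial>lborel)
      = (\<integral>\<^sup>+x. g (x - a) * indicator (ball x0 r) x \<partial>distr lborel borel ((+) a))"
      by (simp add: lborel_distr_plus)
    also have "\<dots> = (\<integral>\<^sup>+y. g (a + y - a) * indicator (ball x0 r) (a + y) \<partial>lborel)"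
      by (rule nn_integral_distr) measurable
    also have "\<dots> \<le> ?P"
    proof (rule nn_integral_mono)
      fix y
      have "y \<in> ball x0 (r + \<kappa>)" if "a + y \<in> ball x0 r"
        using norm_triangle_ineq[of "x0 - (a + y)" a] that a by (simp add: dist_norm algebra_simps)
      then show "g (a + y - a) * indicator (ball x0 r) (a + y) \<le> g y * indicator (ball x0 (r + \<kappa>)) y"
        by (cases "a + y \<in> ball x0 r") simp_all
    qed
    finally show ?thesis .
  qed
  have "(\<integral>\<^sup>+x\<in>ball x0 r. (\<integral>\<^sup>+z. wt z * (\<integral>\<^sup>+s\<in>{0..1}. g (x - s *\<^sub>R z) \<partial>lborel) \<partial>lborel) \<partial>lborel)
    = (\<integral>\<^sup>+x. (\<integral>\<^sup>+z. wt z * (\<integral>\<^sup>+s. g (x - s *\<^sub>R z) * indicator (ball x0 r) x * indicator {0..1} s \<partial>lborel) \<partial>lborel) \<partial>lborel)"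
  proof (rule nn_integral_cong)
    fix x :: "real^3"
    show "(\<integral>\<^sup>+z. wt z * (\<integral>\<^sup>+s\<in>{0..1}. g (x - s *\<^sub>R z) \<partial>lborel) \<partial>lborel) * indicator (ball x0 r) x
     = (\<integral>\<^sup>+z. wt z * (\<integral>\<^sup>+s. g (x - s *\<^sub>R z) * indicator (ball x0 r) x * indicator {0..1} s \<partial>lborel) \<partial>lborel)"
      by (cases "x \<in> ball x0 r") simp_all
  qed
  also have "\<dots> = (\<integral>\<^sup>+z. (\<integral>\<^sup>+x. wt z * (\<integral>\<^sup>+s. g (x - s *\<^sub>R z) * indicator (ball x0 r) x * indicator {0..1} s \<partial>lborel) \<partial>lborel) \<partial>lborel)"
    by (rule lborel_pair.Fubini'[symmetric]) measurable
  also have "\<dots> \<le> (\<integral>\<^sup>+z. wt z * ?P \<partial>lborel)"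
  proof (rule nn_integral_mono)
    fix z :: "real^3"
    show "(\<integral>\<^sup>+x. wt z * (\<integral>\<^sup>+s. g (x - s *\<^sub>R z) * indicator (ball x0 r) x * indicator {0..1} s \<partial>lborel) \<partial>lborel) \<le> wt z * ?P"
    proof (cases "norm z < \<kappa>")
      case False
      then have "\<theta> (z /\<^sub>R \<kappa>) = 0" using \<kappa> by (intro \<theta>_support) (simp add: field_simps)
      then show ?thesis by (simp add: wt_def)
    next
      case True
      have "(\<integral>\<^sup>+x. wt z * (\<integral>\<^sup>+s. g (x - s *\<^sub>R z) * indicator (ball x0 r) x * indicator {0..1} s \<partial>lborel) \<partial>lborel)
        = wt z * (\<integral>\<^sup>+x. (\<integral>\<^sup>+s. g (x - s *\<^sub>R z) * indicator (ball x0 r) x * indicator {0..1} s \<partial>lborel) \<partial>lborel)"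
        by (rule nn_integral_cmult) measurable
      also have "(\<integral>\<^sup>+x. (\<integral>\<^sup>+s. g (x - s *\<^sub>R z) * indicator (ball x0 r) x * indicator {0..1} s \<partial>lborel) \<partial>lborel)
        = (\<integral>\<^sup>+s. (\<integral>\<^sup>+x. g (x - s *\<^sub>R z) * indicator (ball x0 r) x * indicator {0..1} s \<partial>lborel) \<partial>lborel)"
        by (rule lborel_pair.Fubini'[symmetric]) measurable
      also have "\<dots> \<le> (\<integral>\<^sup>+s. ?P * indicator {0..1::real} s \<partial>lborel)"
      proof (rule nn_integral_mono)
        fix s :: real
        show "(\<integral>\<^sup>+x. g (x - s *\<^sub>R z) * indicator (ball x0 r) x * indicator {0..1} s \<partial>lborel) \<le> ?P * indicator {0..1} s"
        proof (cases "s \<in> {0..1}")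
          case s: True
          then have "norm (s *\<^sub>R z) \<le> norm z" by (simp add: mult_left_le_one_le)
          with True have "norm (s *\<^sub>R z) < \<kappa>" by linarith
          from shift[OF this] show ?thesis using s by simp
        qed simp
      qed
      also have "\<dots> = ?P" by (simp add: nn_integral_cmult_indicator)
      finally show ?thesis by (simp add: mult_left_mono)
    qed
  qed
  also have "\<dots> = ?P * (\<integral>\<^sup>+z. wt z \<partial>lborel)"
    by (subst mult.commute) (rule nn_integral_cmult, measurable)
  also have "\<dots> = ennreal (\<kappa> * C_cutoff \<theta>) * ?P"
    unfolding wt_def weight_scaled[OF \<kappa>] by (rule mult.commute)
  finally show ?thesis unfolding wt_def .
qed

end

section \<open>Borel representatives and joint measurability\<close>

text \<open>The real-valued completion theorem is applied to each coordinate of the extension by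
  zero, and the finitely many null sets are combined.\<close>

lemma lebesgue_on_borel_representative:
  fixes u :: "'a::euclidean_space \<Rightarrow> 'b::euclidean_space"
  assumes S: "S \<in> sets lebesgue" and u: "u \<in> borel_measurable (lebesgue_on S)"
  obtains v where "v \<in> borel_measurable borel" "AE x in lborel. x \<in> S \<longrightarrow> u x = v x"
proof -
  define g where "g x = (if x \<in> S then u x else 0)" for x
  have g: "g \<in> borel_measurable lebesgue"
    unfolding g_def[abs_def] using u by (rule borel_measurable_if_I[OF _ S])
  have "\<exists>h\<in>borel_measurable lborel. AE x in lborel. g x \<bullet> b = h x" for b
  proof (rule completion_ex_borel_measurable_real)
    show "(\<lambda>x. g x \<bullet> b) \<in> borel_measurable lebesgue"
      using g by (intro borel_measurable_inner) auto
  qed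
  then obtain h where h: "\<And>b. h b \<in> borel_measurable lborel" "\<And>b. AE x in lborel. g x \<bullet> b = h b x"
    by metis
  define v where "v x = (\<Sum>b\<in>Basis. h b x *\<^sub>R b)" for x
  show thesis
  proof
    show "v \<in> borel_measurable borel"
      unfolding v_def[abs_def] using h(1) by (intro borel_measurable_sum borel_measurable_scaleR) auto
    have "AE x in lborel. \<forall>b\<in>Basis. g x \<bullet> b = h b x"
      using h(2) by (intro AE_finite_allI) auto
    then show "AE x in lborel. x \<in> S \<longrightarrow> u x = v x"
    proof eventually_elim
      case (elim x)
      then have "v x = (\<Sum>b\<in>Basis. (g x \<bullet> b) *\<^sub>R b)" by (simp add: v_def)
      then show ?case by (simp add: euclidean_representation g_def)
    qed
  qed
qed

lemma borel_measurable_lebesgue_AE_eq: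
  fixes f v :: "'a::euclidean_space \<Rightarrow> 'b::topological_space"
  assumes v: "v \<in> borel_measurable borel" and eq: "AE x in lborel. f x = v x"
  shows "f \<in> borel_measurable lebesgue"
proof (rule measurableI)
  fix A :: "'b set" assume A: "A \<in> sets borel"
  have "f -` A \<in> sets lebesgue"
  proof (rule complete_measure.in_sets_AE[OF completion.complete_measure_axioms])
    show "AE x in lebesgue. x \<in> v -` A \<longleftrightarrow> x \<in> f -` A"
      using AE_completion[OF eq] by eventually_elim simp
    show "v -` A \<in> sets lebesgue" using measurable_sets[OF v A] by simp
  qed simp
  then show "f -` A \<inter> space lebesgue \<in> sets lebesgue" by simp
qed simp

text \<open>Completeness makes the possibly non-Borel integrand Lebesgue measurable, so the
  integrals agree at every x, not merely almost every x. Derivatives of the two convolutions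
  therefore agree too.\<close>

lemma convol_cong_AE:
  assumes k: "test_fun k" and v: "v \<in> borel_measurable borel" and eq: "AE y in lborel. f y = v y"
  shows "convol k f = convol k v"
proof
  fix x
  have "(\<lambda>y. k (x - y) *\<^sub>R v y) \<in> borel_measurable borel"
    using v test_fun_measurable[OF k] by measurable
  moreover have eq': "AE y in lborel. k (x - y) *\<^sub>R f y = k (x - y) *\<^sub>R v y"
    using eq by eventually_elim simp
  ultimately show "convol k f x = convol k v x"
    unfolding convol_def
    by (intro integral_cong_AE borel_measurable_lebesgue_AE_eq AE_completion) auto
qed

text \<open>Tonelli's theorem for a Borel null set covering the exceptional set, so that the
  property itself may be non-measurable.\<close>

lemma AE_lborel_slice:
  fixes P :: "'a::euclidean_space \<times> 'b::euclidean_space \<Rightarrow> bool"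
  assumes "AE p in lborel. P p"
  shows "AE t in lborel. AE y in lborel. P (y, t)"
proof -
  obtain N where N: "N \<in> sets lborel" "emeasure lborel N = 0" "{p. \<not> P p} \<subseteq> N"
    using AE_E[OF assms] by (metis (no_types, lifting) Collect_cong UNIV_I space_borel space_lborel)
  have N' [measurable]: "N \<in> sets (lborel \<Otimes>\<^sub>M lborel)"
    unfolding lborel_prod by (rule N(1))
  have "(\<integral>\<^sup>+t. \<integral>\<^sup>+y. indicator N (y, t) \<partial>lborel \<partial>lborel)
      = (\<integral>\<^sup>+p. indicator N p \<partial>(lborel \<Otimes>\<^sub>M lborel))"
    by (rule lborel_pair.nn_integral_snd) measurable
  also have "\<dots> = 0" using N by (simp add: lborel_prod)
  finally have "AE t in lborel. (\<integral>\<^sup>+y. indicator N (y, t) \<partial>lborel) = 0"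
    by (subst (asm) nn_integral_0_iff_AE) measurable
  then show ?thesis
  proof eventually_elim
    case (elim t)
    then have "AE y in lborel. (indicator N (y, t) :: ennreal) = 0"
      by (subst (asm) nn_integral_0_iff_AE) measurable
    then show ?case
      by eventually_elim (use N(3) in \<open>auto simp: indicator_def split: if_splits\<close>)
  qed
qed

text \<open>An exceptional set of times times all of space is null, because infinity times 0 is 0 in
  \<open>ennreal\<close>.\<close>

lemma AE_lborel_snd:
  fixes Q :: "'b::euclidean_space \<Rightarrow> bool"
  assumes "AE t in lborel. Q t"
  shows "AE p in (lborel :: ('a::euclidean_space \<times> 'b) measure). Q (snd p)"
proof -
  obtain N where N: "N \<in> sets lborel" "emeasure lborel N = 0" "{t. \<not> Q t} \<subseteq> N"
    using AE_E[OF assms] by (metis (no_types, lifting) Collect_cong UNIV_I space_borel space_lborel)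
  show ?thesis
  proof (rule AE_I)
    show "{p \<in> space lborel. \<not> Q (snd p)} \<subseteq> UNIV \<times> N" using N(3) by auto
    have "emeasure (lborel \<Otimes>\<^sub>M lborel) ((UNIV :: 'a set) \<times> N) = emeasure lborel (UNIV :: 'a set) * emeasure lborel N"
      by (rule lborel.emeasure_pair_measure_Times) (use N in auto)
    then show "emeasure lborel ((UNIV :: 'a set) \<times> N) = 0" using N by (simp add: lborel_prod)
    have "(UNIV :: 'a set) \<times> N \<in> sets (lborel \<Otimes>\<^sub>M lborel)" using N by (intro pair_measureI) auto
    then show "(UNIV :: 'a set) \<times> N \<in> sets lborel" unfolding lborel_prod .
  qed
qed

text \<open>Integrals with parameters are measurable for a Borel w on the product space; this is
  where the Borel representative is indispensable.\<close>

lemma convol_joint_measurable: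
  fixes w :: "(real^3) \<times> real \<Rightarrow> real^3"
  assumes k: "test_fun k" and w: "w \<in> borel_measurable borel"
  shows "(\<lambda>p. convol k (\<lambda>y. w (y, snd p)) (fst p)) \<in> borel_measurable (borel \<Otimes>\<^sub>M borel)"
proof -
  have [measurable]: "k \<in> borel_measurable borel" by (rule test_fun_measurable[OF k])
  have [measurable]: "w \<in> borel_measurable (borel \<Otimes>\<^sub>M borel)" using w by (simp add: borel_prod)
  have "convol k (\<lambda>y. w (y, t)) x = (\<integral>y. k (x - y) *\<^sub>R w (y, t) \<partial>lborel)" for x t
    by (rule convol_lborel[OF k]) measurable
  then show ?thesis by simp
qed

lemma vort_joint_measurable:
  fixes w :: "(real^3) \<times> real \<Rightarrow> real^3"
  assumes k: "test_fun k" and w: "w \<in> borel_measurable borel"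
  shows "(\<lambda>p. vort k (\<lambda>y. w (y, snd p)) (fst p)) \<in> borel_measurable (borel \<Otimes>\<^sub>M borel)"
proof -
  note [measurable] = convol_joint_measurable[OF test_fun_dird[OF k] w]
  show ?thesis unfolding vort_def by measurable
qed

lemma grad_vort_joint_measurable:
  fixes w :: "(real^3) \<times> real \<Rightarrow> real^3"
  assumes k: "test_fun k" and w: "w \<in> borel_measurable borel" and loc: "\<And>t. loc_int (\<lambda>y. w (y, t))"
  shows "(\<lambda>p. (norm (grad (vort k (\<lambda>y. w (y, snd p))) (fst p)))\<^sup>2) \<in> borel_measurable (borel \<Otimes>\<^sub>M borel)"
proof -
  note [measurable] = convol_joint_measurable[OF test_fun_dird[OF test_fun_dird[OF k]] w]
  show ?thesis unfolding grad_vort_norm[OF k loc] dvort_def by measurable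
qed

lemma Omega_eq_vort:
  assumes \<phi>: "\<phi> \<in> Cc_infty (ball 0 1)" "l > 0" and v: "loc_int v"
    and eq: "AE y in lborel. u (y, t) = v y"
  shows "Omega \<phi> l u (x, t) = vort (rescale l \<phi>) v x"
proof -
  note k = test_fun_rescale[OF \<phi>]
  have "convol (rescale l \<phi>) (\<lambda>y. u (y, t)) = convol (rescale l \<phi>) v"
    by (rule convol_cong_AE[OF k loc_int_measurable[OF v] eq])
  then have "(\<lambda>y. U_filt \<phi> l u (y, t)) = convol (rescale l \<phi>) v"
    by (simp add: U_filt_def fun_eq_iff)
  then show ?thesis
    by (simp add: Omega_def curl_convol[OF k v])
qed

text \<open>The agreement is stated slice by slice because the vorticity at time t depends on u only
  through the class of its slice at t.\<close>

lemma Linf_L2_borel_representative: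
  assumes u: "u \<in> Linf_L2 I" and I [measurable]: "I \<in> sets borel"
  obtains w where "w \<in> borel_measurable borel"
    "\<And>t. (\<integral>\<^sup>+y. ennreal ((norm (w (y, t)))\<^sup>2) \<partial>lborel) < \<infinity>"
    "AE t in lborel. t \<in> I \<longrightarrow> (AE y in lborel. u (y, t) = w (y, t))"
proof -
  have S: "(UNIV :: (real^3) set) \<times> I \<in> sets lebesgue"
  proof -
    have "(UNIV :: (real^3) set) \<times> I \<in> sets (borel \<Otimes>\<^sub>M borel)" by (intro pair_measureI) auto
    then have "(UNIV :: (real^3) set) \<times> I \<in> sets borel" by (simp only: borel_prod)
    then show ?thesis by simp
  qed
  have um: "u \<in> borel_measurable (lebesgue_on (UNIV \<times> I))"
    and ufin: "esssup (lebesgue_on I) (\<lambda>t. \<integral>\<^sup>+x. ennreal ((norm (u (x, t)))\<^sup>2) \<partial>lebesgue) < \<infinity>"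
    using u unfolding Linf_L2_def by blast+
  obtain v where v: "v \<in> borel_measurable borel" "AE p in lborel. p \<in> UNIV \<times> I \<longrightarrow> u p = v p"
    using lebesgue_on_borel_representative[OF S um] by blast
  have [measurable]: "v \<in> borel_measurable (borel \<Otimes>\<^sub>M borel)" using v(1) by (simp add: borel_prod)
  define n where "n t = (\<integral>\<^sup>+y. ennreal ((norm (v (y, t)))\<^sup>2) \<partial>lborel)" for t
  have [measurable]: "n \<in> borel_measurable borel" unfolding n_def[abs_def] by measurable
  \<comment> \<open>truncated so that every slice, not just almost every one, is square integrable\<close>
  define w where "w p = (if n (snd p) < \<infinity> then v p else 0)" for p
  show thesis
  proof
    have "w \<in> borel_measurable (borel \<Otimes>\<^sub>M borel)" unfolding w_def[abs_def] by measurable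
    then show "w \<in> borel_measurable borel" by (simp add: borel_prod)
    show "(\<integral>\<^sup>+y. ennreal ((norm (w (y, t)))\<^sup>2) \<partial>lborel) < \<infinity>" for t
      by (cases "n t < \<infinity>") (simp_all add: w_def n_def)
    have "AE t in lebesgue_on I. (\<integral>\<^sup>+x. ennreal ((norm (u (x, t)))\<^sup>2) \<partial>lebesgue) < \<infinity>"
      using esssup_AE[of "\<lambda>t. \<integral>\<^sup>+x. ennreal ((norm (u (x, t)))\<^sup>2) \<partial>lebesgue" "lebesgue_on I"]
    proof eventually_elim
      case (elim t)
      from le_less_trans[OF elim ufin] show ?case .
    qed
    then have "AE t in lborel. t \<in> I \<longrightarrow> (\<integral>\<^sup>+x. ennreal ((norm (u (x, t)))\<^sup>2) \<partial>lborel) < \<infinity>"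
      by (simp add: AE_restrict_space_iff AE_completion_iff nn_integral_completion)
    moreover have "AE t in lborel. AE y in lborel. t \<in> I \<longrightarrow> u (y, t) = v (y, t)"
      using AE_lborel_slice[OF v(2)] by simp
    ultimately show "AE t in lborel. t \<in> I \<longrightarrow> (AE y in lborel. u (y, t) = w (y, t))"
    proof eventually_elim
      case (elim t)
      show ?case
      proof
        assume t: "t \<in> I"
        then have eq: "AE y in lborel. u (y, t) = v (y, t)" using elim by simp
        then have "n t = (\<integral>\<^sup>+x. ennreal ((norm (u (x, t)))\<^sup>2) \<partial>lborel)"
          unfolding n_def by (intro nn_integral_cong_AE) auto
        then have "n t < \<infinity>" using elim t by simp
        then show "AE y in lborel. u (y, t) = w (y, t)" using eq by (simp add: w_def)
      qed
    qed
  qed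
qed

lemma borel_measurable_Cc_infty: "f \<in> Cc_infty S \<Longrightarrow> f \<in> borel_measurable borel"
  unfolding Cc_infty_def
  by (intro borel_measurable_continuous_onI) (metis (mono_tags, lifting) Ck.simps(1) mem_Collect_eq)

lemma (in cutoff) near_young_strain:
  fixes x :: "real^3"
  assumes \<kappa>: "\<kappa> > 0" and k: "test_fun k" "loc_int f" and c: "0 \<le> c" "c \<le> 1" and \<epsilon>: "\<epsilon> < 1"
  defines "w \<equiv> vort k f x"
  shows "ennreal (c * max 0 ((((3 / (8 * pi)) *\<^sub>R pv_integral (\<lambda>z. kern \<kappa> z (vort k f (x - z)))) *v w) \<bullet> w))
    \<le> ennreal ((1 - \<epsilon>) / (\<kappa> * C_cutoff \<theta>)) * (\<integral>\<^sup>+z. ennreal (\<theta> (z /\<^sub>R \<kappa>) / (norm z)\<^sup>2) *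
          (\<integral>\<^sup>+s\<in>{0..1}. ennreal ((norm (grad (vort k f) (x - s *\<^sub>R z)))\<^sup>2) \<partial>lborel) \<partial>lborel)
      + ennreal (9 * \<kappa>\<^sup>2 * (C_cutoff \<theta>)\<^sup>2 / (64 * pi\<^sup>2 * (1 - \<epsilon>))) * ennreal (c * norm w ^ 4)"
proof -
  \<comment> \<open>Solves \<open>3 / (8 * pi) * (2 * \<eta>) = (1 - \<epsilon>) / (\<kappa> *
    C_cutoff \<theta>)\<close>, whose denominator is the mass that \<open>near_gradient\<close> will
    supply.\<close>
  define \<eta> where "\<eta> = 4 * pi * (1 - \<epsilon>) / (3 * \<kappa> * C_cutoff \<theta>)"
  note pos = C_cutoff_pos \<kappa> pi_gt_zero
  have \<eta>: "\<eta> > 0" using pos \<epsilon> by (simp add: \<eta>_def)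
  define q where "q = (pv_integral (\<lambda>z. kern \<kappa> z (vort k f (x - z))) *v w) \<bullet> w"
  define X where "X = (\<integral>\<^sup>+z. ennreal (\<theta> (z /\<^sub>R \<kappa>) / (norm z)\<^sup>2) *
          (\<integral>\<^sup>+s\<in>{0..1}. ennreal ((norm (grad (vort k f) (x - s *\<^sub>R z)))\<^sup>2) \<partial>lborel) \<partial>lborel)"
  have scaled: "(((3 / (8 * pi)) *\<^sub>R pv_integral (\<lambda>z. kern \<kappa> z (vort k f (x - z)))) *v w) \<bullet> w = (3 / (8 * pi)) * q"
    by (simp add: q_def scaleR_matrix_vector_assoc[symmetric])
  have "max 0 (a * q) = a * max 0 q" if "a > 0" for a :: real
    using that by (simp add: max_def zero_le_mult_iff)
  from this[of "3 / (8 * pi)"]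
  have "c * max 0 ((((3 / (8 * pi)) *\<^sub>R pv_integral (\<lambda>z. kern \<kappa> z (vort k f (x - z)))) *v w) \<bullet> w) = (3 / (8 * pi)) * (c * max 0 q)"
    unfolding scaled by (simp only: mult.left_commute) simp
  then have "ennreal (c * max 0 ((((3 / (8 * pi)) *\<^sub>R pv_integral (\<lambda>z. kern \<kappa> z (vort k f (x - z)))) *v w) \<bullet> w))
      = ennreal (3 / (8 * pi)) * ennreal (c * max 0 q)"
    using c by (simp only:) (rule ennreal_mult, simp_all)
  also have "\<dots> \<le> ennreal (3 / (8 * pi)) * (ennreal (2 * \<eta>) * X
      + ennreal (\<kappa> * C_cutoff \<theta> / (2 * \<eta>)) * ennreal (c * norm w ^ 4))"
    unfolding q_def X_def w_def by (intro mult_left_mono near_young \<kappa> k c \<eta>) simp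
  also have "\<dots> = ennreal (3 / (8 * pi) * (2 * \<eta>)) * X
      + ennreal (3 / (8 * pi) * (\<kappa> * C_cutoff \<theta> / (2 * \<eta>))) * ennreal (c * norm w ^ 4)"
  proof -
    have "0 \<le> 3 / (8 * pi)" "0 \<le> 2 * \<eta>" "0 \<le> \<kappa> * C_cutoff \<theta> / (2 * \<eta>)" using pos \<eta> by simp_all
    then show ?thesis by (simp only: ennreal_mult distrib_left mult.assoc)
  qed
  also have "3 / (8 * pi) * (2 * \<eta>) = (1 - \<epsilon>) / (\<kappa> * C_cutoff \<theta>)"
    using pos by (simp add: \<eta>_def field_simps)
  also have "3 / (8 * pi) * (\<kappa> * C_cutoff \<theta> / (2 * \<eta>)) = 9 * \<kappa>\<^sup>2 * (C_cutoff \<theta>)\<^sup>2 / (64 * pi\<^sup>2 * (1 - \<epsilon>))"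
    using pos \<epsilon> by (simp add: \<eta>_def field_simps power2_eq_square)
  finally show ?thesis unfolding X_def .
qed

section \<open>Integration over the cylinder and collection of constants\<close>

theorem corollary2p3:
  fixes \<phi> \<theta> :: "real^3 \<Rightarrow> real" and C\<^sub>\<phi> :: real
    and x0 :: "real^3" and t0 r \<rho> l \<epsilon> :: real
    and u :: "(real^3) \<times> real \<Rightarrow> real^3"
    and chi :: "(real^3) \<times> real \<Rightarrow> real"
  assumes "\<phi> \<in> Cc_infty (ball 0 1)"
    and "\<And>x. \<phi> x \<ge> 0"
    and "(\<integral>x. \<phi> x \<partial>lebesgue) = 1"
    and "C\<^sub>\<phi> > 0"
    and "curl_filter_bound \<phi> C\<^sub>\<phi>"
    and "\<theta> \<in> Cc_infty (ball 0 1)"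
    and "radial \<theta>"
    and "\<And>x. 0 \<le> \<theta> x \<and> \<theta> x \<le> 1"
    and "\<And>x. x \<in> ball 0 (1 / 2) \<Longrightarrow> \<theta> x = 1"
    and "r > 0"
    and "0 < \<rho>" and "\<rho> \<le> 1 / 4"
    and "0 < l" and "l \<le> \<rho> * r"
    and "u \<in> Linf_L2 (I_int t0 r)"
    and "div_free (I_int t0 r) u"
    and "chi \<in> Cc_infty (Q_cyl x0 t0 r)"
    and "\<And>p. 0 \<le> chi p \<and> chi p \<le> 1"
    and "0 < \<epsilon>" and "\<epsilon> < 1"
  shows "V_near x0 t0 r \<rho> \<theta> \<phi> l u chi
      \<le> ennreal (1 - \<epsilon>) * P_quant x0 t0 r \<rho> \<phi> l u
        + ennreal (9 * (C_cutoff \<theta>)\<^sup>2 * C\<^sub>\<phi>\<^sup>2 / (64 * pi\<^sup>2 * (1 - \<epsilon>)) * \<rho>\<^sup>2)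
          * M_quant x0 t0 r \<rho> u * ennreal ((r / l) ^ 5) * O_quant x0 t0 r \<phi> l u chi"
proof -
  interpret cutoff \<theta>
    by unfold_locales (use assms(6-9) in auto)
  define \<kappa> where "\<kappa> = \<rho> * r"
  define C where "C = C_cutoff \<theta>"
  define k where "k = rescale l \<phi>"
  define I where "I = I_int t0 r"
  define B where "B = ball x0 r"
  define B' where "B' = ball x0 ((1 + 2 * \<rho>) * r)"
  \<comment> \<open>The local energy bound, equal to r times \<open>M_quant\<close>.\<close>
  define E where "E = esssup (lebesgue_on I)
       (\<lambda>t. \<integral>\<^sup>+x\<in>B'. ennreal ((norm (u (x, t)))\<^sup>2) \<partial>lebesgue)"
  define Kc where "Kc = 9 * \<kappa>\<^sup>2 * C\<^sup>2 / (64 * pi\<^sup>2 * (1 - \<epsilon>))"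
  define c1 where "c1 = (1 - \<epsilon>) / (\<kappa> * C)"
  have r: "r > 0" and l: "l > 0" and \<epsilon>: "\<epsilon> < 1" and chi: "0 \<le> chi p" "chi p \<le> 1" for p
    using assms by auto
  have \<kappa>: "\<kappa> > 0" using assms by (simp add: \<kappa>_def)
  have C: "C > 0" unfolding C_def by (rule C_cutoff_pos)
  have Kc: "Kc \<ge> 0" using \<epsilon> by (simp add: Kc_def)
  have c1: "c1 \<ge> 0" using \<epsilon> C \<kappa> by (simp add: c1_def)
  have k: "test_fun k" unfolding k_def by (rule test_fun_rescale[OF assms(1) l])
  have [measurable]: "I \<in> sets borel" "B \<in> sets borel" "B' \<in> sets borel"
    by (simp_all add: I_def I_int_def B_def B'_def)
  have Q: "Q_cyl x0 t0 r = B \<times> I" by (simp add: Q_cyl_def B_def I_def)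
  have chi_m [measurable]: "chi \<in> borel_measurable (borel \<Otimes>\<^sub>M borel)"
    using borel_measurable_Cc_infty[OF assms(17)] by (simp add: borel_prod)

  obtain w where w: "w \<in> borel_measurable borel"
      "\<And>t. (\<integral>\<^sup>+y. ennreal ((norm (w (y, t)))\<^sup>2) \<partial>lborel) < \<infinity>"
      "AE t in lborel. t \<in> I \<longrightarrow> (AE y in lborel. u (y, t) = w (y, t))"
    using Linf_L2_borel_representative[OF assms(15)[folded I_def]] by auto
  have [measurable]: "w \<in> borel_measurable (borel \<Otimes>\<^sub>M borel)" using w(1) by (simp add: borel_prod)
  have slice: "(\<lambda>y. w (y, t)) \<in> borel_measurable borel" for t by measurable
  have loc: "loc_int (\<lambda>y. w (y, t))" for t by (rule L2_loc_int[OF slice w(2)])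
  define W where "W x t = vort k (\<lambda>y. w (y, t)) x" for x t
  define G where "G x t = (norm (grad (vort k (\<lambda>y. w (y, t))) x))\<^sup>2" for x t
  have [measurable]: "case_prod W \<in> borel_measurable (borel \<Otimes>\<^sub>M borel)"
    using vort_joint_measurable[OF k w(1)] by (simp add: W_def case_prod_unfold)
  have [measurable]: "case_prod G \<in> borel_measurable (borel \<Otimes>\<^sub>M borel)"
    using grad_vort_joint_measurable[OF k w(1) loc] by (simp add: G_def case_prod_unfold)
  define X where "X x t = (\<integral>\<^sup>+z. ennreal (\<theta> (z /\<^sub>R \<kappa>) / (norm z)\<^sup>2) *
      (\<integral>\<^sup>+s\<in>{0..1}. ennreal (G (x - s *\<^sub>R z) t) \<partial>lborel) \<partial>lborel)" for x t
  have [measurable]: "case_prod X \<in> borel_measurable (borel \<Otimes>\<^sub>M borel)"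
    unfolding X_def[abs_def] by measurable

  have AE_E: "AE t in lborel. t \<in> I \<longrightarrow> (\<integral>\<^sup>+x\<in>B'. ennreal ((norm (u (x, t)))\<^sup>2) \<partial>lborel) \<le> E"
  proof -
    have "AE t in lebesgue_on I. (\<integral>\<^sup>+x\<in>B'. ennreal ((norm (u (x, t)))\<^sup>2) \<partial>lebesgue) \<le> E"
      unfolding E_def by (rule esssup_AE)
    then show ?thesis
      by (simp add: AE_restrict_space_iff AE_completion_iff nn_integral_completion)
  qed
  \<comment> \<open>Equality at every x is essential: the strain at one point is a principal value
    over the whole slice.\<close>
  have Omega_W: "AE t in lborel. t \<in> I \<longrightarrow> (\<forall>x. Omega \<phi> l u (x, t) = W x t)"
    using w(3) by eventually_elim (simp add: W_def k_def Omega_eq_vort[OF assms(1) l loc])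
  have W_bound: "AE t in lborel. t \<in> I \<longrightarrow>
      (\<forall>x\<in>B. ennreal ((norm (W x t))\<^sup>2) \<le> ennreal (C\<^sub>\<phi>\<^sup>2 / l ^ 5) * E)"
    using AE_E w(3)
  proof eventually_elim
    case (elim t)
    show ?case
    proof (intro impI ballI)
      fix x assume t: "t \<in> I" and x: "x \<in> B"
      \<comment> \<open>The filter at x in the ball of radius r sees only points within l, and r + l
        is at most (1 + 2 \<rho>) r.\<close>
      have sub: "cball x l \<subseteq> B'"
      proof
        fix y assume "y \<in> cball x l"
        then have "dist x0 y < r + l"
          using x dist_triangle[of x0 y x] by (simp add: B_def)
        also have "\<dots> \<le> (1 + 2 * \<rho>) * r"
          using assms(14) \<kappa> by (simp add: \<kappa>_def distrib_right mult.assoc)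
        finally show "y \<in> B'" by (simp add: B'_def)
      qed
      have "ennreal ((norm (W x t))\<^sup>2)
        \<le> ennreal (C\<^sub>\<phi>\<^sup>2 / l ^ 5) * (\<integral>\<^sup>+y. ennreal ((norm (w (y, t)))\<^sup>2) * indicator B' y \<partial>lborel)"
        unfolding W_def k_def
        by (rule vort_pointwise_bound[OF assms(5,4,1) l slice w(2) _ sub]) simp
      also have "(\<integral>\<^sup>+y. ennreal ((norm (w (y, t)))\<^sup>2) * indicator B' y \<partial>lborel)
          = (\<integral>\<^sup>+y\<in>B'. ennreal ((norm (u (y, t)))\<^sup>2) \<partial>lborel)"
        by (rule nn_integral_cong_AE) (use elim t in auto)
      also have "ennreal (C\<^sub>\<phi>\<^sup>2 / l ^ 5) * \<dots> \<le> ennreal (C\<^sub>\<phi>\<^sup>2 / l ^ 5) * E"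
        using elim t by (intro mult_left_mono) auto
      finally show "ennreal ((norm (W x t))\<^sup>2) \<le> ennreal (C\<^sub>\<phi>\<^sup>2 / l ^ 5) * E" .
    qed
  qed

  \<comment> \<open>The integrand of \<open>V_near\<close> is not known to be measurable, so it is dominated by a Borel function
    before Tonelli's theorem is applied.\<close>
  define a where "a p = ennreal c1 * (X (fst p) (snd p) * indicator B (fst p)) * indicator I (snd p)" for p
  define b where "b p = ennreal (chi p * (norm (W (fst p) (snd p)))\<^sup>2) * indicator (B \<times> I) p" for p
  have [measurable]: "a \<in> borel_measurable (borel \<Otimes>\<^sub>M borel)"
    unfolding a_def[abs_def] by measurable
  have [measurable]: "b \<in> borel_measurable (borel \<Otimes>\<^sub>M borel)"
    unfolding b_def[abs_def] by measurable
  have ab: "a \<in> borel_measurable lborel" "b \<in> borel_measurable lborel"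
    using \<open>a \<in> borel_measurable (borel \<Otimes>\<^sub>M borel)\<close> \<open>b \<in> borel_measurable (borel \<Otimes>\<^sub>M borel)\<close>
    by (simp_all add: borel_prod)
  \<comment> \<open>Of the four powers of the vorticity in the Young remainder, two are bounded
    through E; the other two stay in b.\<close>
  define K2 where "K2 = ennreal Kc * (ennreal (C\<^sub>\<phi>\<^sup>2 / l ^ 5) * E)"

  have "(\<integral>\<^sup>+p\<in>Q_cyl x0 t0 r. ennreal (chi p *
        max 0 ((S_near \<theta> (\<rho> * r) (Omega \<phi> l u) p *v Omega \<phi> l u p) \<bullet> Omega \<phi> l u p)) \<partial>lebesgue)
    = (\<integral>\<^sup>+p\<in>B \<times> I. ennreal (chi p *
        max 0 ((S_near \<theta> \<kappa> (Omega \<phi> l u) p *v Omega \<phi> l u p) \<bullet> Omega \<phi> l u p)) \<partial>lborel)"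
    \<comment> \<open>Passing from \<open>lebesgue\<close> to \<open>lborel\<close> in a nonnegative
      integral asks for no measurability, and neither does the domination that follows.\<close>
    unfolding Q \<kappa>_def by (rule nn_integral_completion)
  also have "\<dots> \<le> (\<integral>\<^sup>+p. a p + K2 * b p \<partial>lborel)"
  proof (rule nn_integral_mono_AE)
    have "AE p in (lborel :: ((real^3) \<times> real) measure). snd p \<in> I \<longrightarrow>
        (\<forall>x. Omega \<phi> l u (x, snd p) = W x (snd p)) \<and>
        (\<forall>x\<in>B. ennreal ((norm (W x (snd p)))\<^sup>2) \<le> ennreal (C\<^sub>\<phi>\<^sup>2 / l ^ 5) * E)"
      by (rule AE_lborel_snd) (use Omega_W W_bound in eventually_elim, blast)
    then show "AE p in (lborel :: ((real^3) \<times> real) measure). ennreal (chi p *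
        max 0 ((S_near \<theta> \<kappa> (Omega \<phi> l u) p *v Omega \<phi> l u p) \<bullet> Omega \<phi> l u p)) * indicator (B \<times> I) p
        \<le> a p + K2 * b p"
    proof eventually_elim
      case (elim p)
      obtain x t where p: "p = (x, t)" by (cases p)
      show ?case
      proof (cases "x \<in> B \<and> t \<in> I")
        case False
        then have "indicator (B \<times> I) p = (0::ennreal)" using p by simp
        then show ?thesis by simp
      next
        case True
        then have Om: "Omega \<phi> l u (x', t) = W x' t" for x' using elim p by simp
        have "ennreal (chi p * norm (W x t) ^ 4)
            = ennreal ((norm (W x t))\<^sup>2) * ennreal (chi p * (norm (W x t))\<^sup>2)"
          using chi[of p] by (simp add: ennreal_mult[symmetric] mult_ac flip: power_add)
        also have "\<dots> \<le> (ennreal (C\<^sub>\<phi>\<^sup>2 / l ^ 5) * E) * ennreal (chi p * (norm (W x t))\<^sup>2)"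
          using elim p True by (intro mult_right_mono) auto
        finally have 4: "ennreal (chi p * norm (W x t) ^ 4)
            \<le> (ennreal (C\<^sub>\<phi>\<^sup>2 / l ^ 5) * E) * ennreal (chi p * (norm (W x t))\<^sup>2)" .
        have "ennreal (chi p * max 0 ((S_near \<theta> \<kappa> (Omega \<phi> l u) p *v Omega \<phi> l u p) \<bullet> Omega \<phi> l u p))
          \<le> ennreal c1 * X x t + ennreal Kc * ennreal (chi p * norm (W x t) ^ 4)"
          unfolding p S_near_kern Om
          using near_young_strain[OF \<kappa> k loc[of t] chi[of "(x, t)"] \<epsilon>, of x]
          by (simp only: W_def X_def G_def c1_def Kc_def C_def)
        also have "\<dots> \<le> ennreal c1 * X x t
            + ennreal Kc * ((ennreal (C\<^sub>\<phi>\<^sup>2 / l ^ 5) * E) * ennreal (chi p * (norm (W x t))\<^sup>2))"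
          by (intro add_left_mono mult_left_mono 4) simp
        also have "\<dots> = a p + K2 * b p"
          using True by (simp add: a_def b_def K2_def p mult.assoc)
        finally show ?thesis using True p by simp
      qed
    qed
  qed
  also have "\<dots> = (\<integral>\<^sup>+p. a p \<partial>lborel) + (\<integral>\<^sup>+p. K2 * b p \<partial>lborel)"
    by (rule nn_integral_add) (use ab in \<open>auto intro: borel_measurable_times\<close>)
  also have "(\<integral>\<^sup>+p. K2 * b p \<partial>lborel) = K2 * (\<integral>\<^sup>+p. b p \<partial>lborel)"
    by (rule nn_integral_cmult[OF ab(2)])
  also have "(\<integral>\<^sup>+p. b p \<partial>lborel) = (\<integral>\<^sup>+p\<in>Q_cyl x0 t0 r. ennreal (chi p * (norm (Omega \<phi> l u p))\<^sup>2) \<partial>lebesgue)"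
    unfolding nn_integral_completion Q
  proof (rule nn_integral_cong_AE)
    show "AE p in (lborel :: ((real^3) \<times> real) measure).
        b p = ennreal (chi p * (norm (Omega \<phi> l u p))\<^sup>2) * indicator (B \<times> I) p"
      using AE_lborel_snd[OF Omega_W]
    proof eventually_elim
      case (elim p)
      then show ?case by (cases p) (auto simp: b_def indicator_def)
    qed
  qed
  also have "(\<integral>\<^sup>+p. a p \<partial>lborel) \<le> ennreal (1 - \<epsilon>) * (\<integral>\<^sup>+t\<in>I. (\<integral>\<^sup>+x\<in>ball x0 ((1 + \<rho>) * r).
        ennreal ((norm (grad (\<lambda>y. Omega \<phi> l u (y, t)) x))\<^sup>2) \<partial>lebesgue) \<partial>lebesgue)"
  proof -
    have [measurable]: "ball x0 (r + \<kappa>) \<in> sets borel" by simp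
    have rad: "(1 + \<rho>) * r = r + \<kappa>" by (simp add: \<kappa>_def algebra_simps)
    have "(\<integral>\<^sup>+p. a p \<partial>lborel) = (\<integral>\<^sup>+p. a p \<partial>(lborel \<Otimes>\<^sub>M lborel))" by (simp add: lborel_prod)
    also have "\<dots> = (\<integral>\<^sup>+t. (\<integral>\<^sup>+x. a (x, t) \<partial>lborel) \<partial>lborel)"
      by (rule lborel_pair.nn_integral_snd[symmetric]) measurable
    also have "\<dots> \<le> (\<integral>\<^sup>+t. ennreal (1 - \<epsilon>) * ((\<integral>\<^sup>+x\<in>ball x0 (r + \<kappa>). ennreal (G x t) \<partial>lborel) * indicator I t) \<partial>lborel)"
    proof (rule nn_integral_mono)
      fix t
      have "(\<integral>\<^sup>+x. a (x, t) \<partial>lborel) = ennreal c1 * (\<integral>\<^sup>+x\<in>B. X x t \<partial>lborel) * indicator I t"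
        unfolding a_def fst_conv snd_conv by (simp add: nn_integral_multc nn_integral_cmult)
      also have "\<dots> \<le> ennreal c1 * (ennreal (\<kappa> * C) * (\<integral>\<^sup>+x\<in>ball x0 (r + \<kappa>). ennreal (G x t) \<partial>lborel)) * indicator I t"
        unfolding X_def B_def C_def
        by (intro mult_right_mono mult_left_mono near_gradient[OF \<kappa>]) (simp_all, measurable)
      also have "\<dots> = (ennreal c1 * ennreal (\<kappa> * C)) * ((\<integral>\<^sup>+x\<in>ball x0 (r + \<kappa>). ennreal (G x t) \<partial>lborel) * indicator I t)"
        by (simp only: mult.assoc)
      \<comment> \<open>The mass of the weight cancels against the choice of Young's
        parameter.\<close>
      also have "ennreal c1 * ennreal (\<kappa> * C) = ennreal (1 - \<epsilon>)"
      proof -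
        have "c1 * (\<kappa> * C) = 1 - \<epsilon>" using \<kappa> C by (simp add: c1_def)
        then show ?thesis using c1 \<kappa> C by (metis ennreal_mult less_imp_le mult_pos_pos)
      qed
      finally show "(\<integral>\<^sup>+x. a (x, t) \<partial>lborel)
        \<le> ennreal (1 - \<epsilon>) * ((\<integral>\<^sup>+x\<in>ball x0 (r + \<kappa>). ennreal (G x t) \<partial>lborel) * indicator I t)" .
    qed
    also have "\<dots> = ennreal (1 - \<epsilon>) * (\<integral>\<^sup>+t\<in>I. (\<integral>\<^sup>+x\<in>ball x0 (r + \<kappa>). ennreal (G x t) \<partial>lborel) \<partial>lborel)"
      by (rule nn_integral_cmult) measurable
    also have "(\<integral>\<^sup>+t\<in>I. (\<integral>\<^sup>+x\<in>ball x0 (r + \<kappa>). ennreal (G x t) \<partial>lborel) \<partial>lborel)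
      = (\<integral>\<^sup>+t\<in>I. (\<integral>\<^sup>+x\<in>ball x0 ((1 + \<rho>) * r).
        ennreal ((norm (grad (\<lambda>y. Omega \<phi> l u (y, t)) x))\<^sup>2) \<partial>lebesgue) \<partial>lebesgue)"
      unfolding nn_integral_completion rad
    proof (rule nn_integral_cong_AE)
      show "AE t in lborel. (\<integral>\<^sup>+x\<in>ball x0 (r + \<kappa>). ennreal (G x t) \<partial>lborel) * indicator I t
        = (\<integral>\<^sup>+x\<in>ball x0 (r + \<kappa>). ennreal ((norm (grad (\<lambda>y. Omega \<phi> l u (y, t)) x))\<^sup>2) \<partial>lborel) * indicator I t"
        using Omega_W
      proof eventually_elim
        case (elim t)
        show ?case
        proof (cases "t \<in> I")
          case True
          then have "(\<lambda>y. Omega \<phi> l u (y, t)) = vort k (\<lambda>y. w (y, t))"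
            using elim by (simp add: W_def fun_eq_iff)
          then show ?thesis by (simp add: G_def)
        qed simp
      qed
    qed
    finally show ?thesis .
  qed
  finally have main: "(\<integral>\<^sup>+p\<in>Q_cyl x0 t0 r. ennreal (chi p *
        max 0 ((S_near \<theta> (\<rho> * r) (Omega \<phi> l u) p *v Omega \<phi> l u p) \<bullet> Omega \<phi> l u p)) \<partial>lebesgue)
    \<le> ennreal (1 - \<epsilon>) * (\<integral>\<^sup>+t\<in>I. (\<integral>\<^sup>+x\<in>ball x0 ((1 + \<rho>) * r).
        ennreal ((norm (grad (\<lambda>y. Omega \<phi> l u (y, t)) x))\<^sup>2) \<partial>lebesgue) \<partial>lebesgue)
      + K2 * (\<integral>\<^sup>+p\<in>Q_cyl x0 t0 r. ennreal (chi p * (norm (Omega \<phi> l u p))\<^sup>2) \<partial>lebesgue)"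
    by (simp add: add_right_mono)
  define K where "K = 9 * (C_cutoff \<theta>)\<^sup>2 * C\<^sub>\<phi>\<^sup>2 / (64 * pi\<^sup>2 * (1 - \<epsilon>)) * \<rho>\<^sup>2"
  \<comment> \<open>Counting powers: r \<kappa>^2 l^-5 = \<rho>^2 (r / l)^5 r^-2, and the two
    factors 1 / r are the prefactors of \<open>M_quant\<close> and \<open>O_quant\<close>.\<close>
  have const_eq: "ennreal r * K2 * Z
      = ennreal K * (ennreal (1 / r) * E) * ennreal ((r / l) ^ 5) * (ennreal (1 / r) * Z)" for Z
  proof -
    have K: "K \<ge> 0" using \<epsilon> by (simp add: K_def)
    have "r * (Kc * (C\<^sub>\<phi>\<^sup>2 / l ^ 5)) = K * (1 / r) * (r / l) ^ 5 * (1 / r)"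
      using r l \<epsilon> by (simp add: Kc_def K_def \<kappa>_def C_def power_mult_distrib power_divide eval_nat_numeral field_simps)
    then have *: "ennreal r * (ennreal Kc * ennreal (C\<^sub>\<phi>\<^sup>2 / l ^ 5))
        = ennreal K * ennreal (1 / r) * ennreal ((r / l) ^ 5) * ennreal (1 / r)"
      using r l Kc K by (simp add: ennreal_mult[symmetric])
    have "ennreal r * K2 * Z = (ennreal r * (ennreal Kc * ennreal (C\<^sub>\<phi>\<^sup>2 / l ^ 5))) * (E * Z)"
      unfolding K2_def by (simp only: mult_ac)
    then show ?thesis
      unfolding * by (simp only: mult_ac)
  qed
  have "V_near x0 t0 r \<rho> \<theta> \<phi> l u chi
    \<le> ennreal r * (ennreal (1 - \<epsilon>) * (\<integral>\<^sup>+t\<in>I. (\<integral>\<^sup>+x\<in>ball x0 ((1 + \<rho>) * r).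
        ennreal ((norm (grad (\<lambda>y. Omega \<phi> l u (y, t)) x))\<^sup>2) \<partial>lebesgue) \<partial>lebesgue)
      + K2 * (\<integral>\<^sup>+p\<in>Q_cyl x0 t0 r. ennreal (chi p * (norm (Omega \<phi> l u p))\<^sup>2) \<partial>lebesgue))"
    (is "_ \<le> ennreal r * (_ * ?P + _ * ?O)")
    unfolding V_near_def by (rule mult_left_mono[OF main]) simp
  also have "\<dots> = ennreal (1 - \<epsilon>) * (ennreal r * ?P) + ennreal r * K2 * ?O"
    by (simp only: distrib_left mult.assoc mult.left_commute[of "ennreal r" "ennreal (1 - \<epsilon>)"])
  finally show ?thesis
    unfolding const_eq P_quant_def M_quant_def O_quant_def K_def E_def I_def B'_def .
qed

end
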